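(* Let $G$ be a finite abelian group, let $\mathbf{k}$ be a field with $\operatorname{char}\mathbf{k}\nmid |G|$, and let $V$ be a faithful finite-dimensional representation of $G$ over $\mathbf{k}$. Let $m$ be the number of distinct nontrivial characters of $G$ occurring in $V$ (i.e., in $\overline{\mathbf{k}}\otimes_{\mathbf{k}}V$). Then $$\gamma^{\mathbf{r}}_{\mathrm{field}}(G,V)\;\geq\;\sqrt[m]{|G|}.$$
   Context: $\overline{\mathbf{k}}$ is an algebraic closure of $\mathbf{k}$. Since $G$ is abelian and $\operatorname{char}\mathbf{k}\nmid|G|$, $\overline{\mathbf{k}}\otimes_{\mathbf{k}}V$ is a direct sum of one-dimensional representations given by characters $G\to\overline{\mathbf{k}}^\times$; these are the characters occurring in $V$, so $m$ is the number of nontrivial isotypic components of $\overline{\mathbf{k}}\otimes_{\mathbf{k}} V$. The $m$th root is understood for $m\ge 1$. $\mathbf{k}[V]$ is the polynomial ring of $V$ (the symmetric algebra of $V^*$, with its induced $G$-action), $\mathbf{k}(V)$ is its fraction field, and $\mathbf{k}(V)^G$ is the field of invariant rational functions. For $f\in\mathbf{k}(V)$ written as $f=f_1/f_2$ with $f_1,f_2\in\mathbf{k}[V]$ and $\gcd(f_1,f_2)=1$, the degree of $f$ is $\deg f:=\deg f_1+\deg f_2$ (constants, including $0$, have degree $0$). $\mathbf{k}(V)^G_{\leq d}$ is the set of invariant rational functions of degree $\leq d$. Define $$\gamma^{\mathbf{r}}_{\mathrm{field}}(G,V):=\min\{d:\mathbf{k}(V)^G_{\leq d}\text{ contains a transcendence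 basis for }\mathbf{k}(V)^G\text{ over }\mathbf{k}\},$$ the minimum being over positive integers $d$. *)

theory Defs
  imports
    "HOL-Analysis.Cartesian_Space"
    "HOL-Library.Poly_Mapping"
    "HOL-Computational_Algebra.Fraction_Field"
    "HOL-Algebra.Multiplicative_Group"
    "HOL-Algebra.Generated_Fields"
    "HOL-Algebra.Finite_Extensions"
    "HOL-Algebra.Algebraic_Closure_Type"
begin

text \<open>
  The field is a type \<open>'k :: field\<close> and the representation space is \<open>V = 'k ^ 'n\<close>, so that
  \<open>'k[V]\<close> is the polynomial ring in the coordinate functions \<open>x\<^sub>i\<close>, \<open>i :: 'n\<close>. The order on \<open>'n\<close>
  plays no role in the mathematics; it is what makes the polynomial ring an instance of \<open>idom\<close>.
\<close>

type_synonym ('n, 'k) mpoly = "('n \<Rightarrow>\<^sub>0 nat) \<Rightarrow>\<^sub>0 'k"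
type_synonym ('n, 'k) ratfun = "('n, 'k) mpoly fract"

definition mpoly_const :: "'k::zero \<Rightarrow> ('n, 'k) mpoly" where
  "mpoly_const c = Poly_Mapping.single 0 c"

definition mpoly_var :: "'n \<Rightarrow> ('n, 'k::zero_neq_one) mpoly" where
  "mpoly_var i = Poly_Mapping.single (Poly_Mapping.single i 1) 1"

text \<open>Evaluation at the point \<open>a\<close>, the coefficients being mapped by \<open>c\<close>.\<close>

definition mpoly_eval ::
  "('k::zero \<Rightarrow> 'b::comm_semiring_1) \<Rightarrow> ('n \<Rightarrow> 'b) \<Rightarrow> ('n, 'k) mpoly \<Rightarrow> 'b" where
  "mpoly_eval c a p =
     (\<Sum>m\<in>Poly_Mapping.keys p.
        c (Poly_Mapping.lookup p m) * (\<Prod>i\<in>Poly_Mapping.keys m. a i ^ Poly_Mapping.lookup m i))"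

definition mpoly_degree :: "('n, 'k::zero) mpoly \<Rightarrow> nat" where
  "mpoly_degree p =
     Max (insert 0 ((\<lambda>m. \<Sum>i\<in>Poly_Mapping.keys m. Poly_Mapping.lookup m i)
                     ` Poly_Mapping.keys p))"

text \<open>\<open>gcd(p, q) = 1\<close>; the constant \<open>coprime\<close> needs a division operation on the type.\<close>

definition mpoly_coprime :: "('n, 'k::field) mpoly \<Rightarrow> ('n, 'k) mpoly \<Rightarrow> bool" where
  "mpoly_coprime p q \<longleftrightarrow> (\<forall>c. c dvd p \<longrightarrow> c dvd q \<longrightarrow> c dvd 1)"

definition ratfun_const :: "'k::field \<Rightarrow> ('n::{finite,linorder}, 'k) ratfun" where
  "ratfun_const c = Fract (mpoly_const c) 1"

text \<open>
  By unique factorisation the coprime numerator and denominator of \<open>f\<close> exist and are unique up to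
  a common constant factor, so exactly one \<open>d\<close> is described here.
\<close>

definition ratfun_degree :: "('n::{finite,linorder}, 'k::field) ratfun \<Rightarrow> nat" where
  "ratfun_degree f =
     (SOME d. \<exists>p q. q \<noteq> 0 \<and> f = Fract p q \<and> mpoly_coprime p q \<and>
                    d = mpoly_degree p + mpoly_degree q)"

text \<open>The substitutions \<open>p \<mapsto> (v \<mapsto> p(A v))\<close> and \<open>f \<mapsto> (v \<mapsto> f(A v))\<close>.\<close>

definition mpoly_subst ::
  "'k::field ^ 'n::{finite,linorder} ^ 'n::{finite,linorder} \<Rightarrow>
     ('n, 'k) mpoly \<Rightarrow> ('n, 'k) mpoly" where
  "mpoly_subst A =
     mpoly_eval mpoly_const (\<lambda>i. \<Sum>j\<in>UNIV. mpoly_const (A $ i $ j) * mpoly_var j)"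

text \<open>Well defined for invertible \<open>A\<close>, which is the only case used.\<close>

definition ratfun_subst ::
  "'k::field ^ 'n::{finite,linorder} ^ 'n::{finite,linorder} \<Rightarrow>
     ('n, 'k) ratfun \<Rightarrow> ('n, 'k) ratfun" where
  "ratfun_subst A f =
     (THE h. \<forall>p q. q \<noteq> 0 \<longrightarrow> f = Fract p q \<longrightarrow> h = Fract (mpoly_subst A p) (mpoly_subst A q))"

definition GL :: "('k::field ^ 'n ^ 'n) monoid" where
  "GL = \<lparr>carrier = {A. invertible A}, monoid.mult = (**), one = mat 1\<rparr>"

text \<open>
  \<open>'k(V)\<^sup>G\<close> for the representation \<open>\<rho>\<close>; the induced action is \<open>(g f)(v) = f(g\<^sup>-\<^sup>1 v)\<close>.
\<close>

definition invariant_field ::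
  "('g, 'x) monoid_scheme \<Rightarrow> ('g \<Rightarrow> 'k::field ^ 'n::{finite,linorder} ^ 'n::{finite,linorder}) \<Rightarrow>
     ('n, 'k) ratfun set" where
  "invariant_field G \<rho> = {f. \<forall>g\<in>carrier G. ratfun_subst (\<rho> (inv\<^bsub>G\<^esub> g)) f = f}"

text \<open>
  In the next two definitions \<open>c\<close> embeds the ground field into the field \<open>'f\<close>. The polynomials
  witnessing algebraic dependence have the elements of \<open>S\<close> themselves as variables.
\<close>

definition algebraically_independent :: "('k::field \<Rightarrow> 'f::field) \<Rightarrow> 'f set \<Rightarrow> bool" where
  "algebraically_independent c S \<longleftrightarrow>
     (\<forall>P :: ('f, 'k) mpoly. (\<forall>m\<in>Poly_Mapping.keys P. Poly_Mapping.keys m \<subseteq> S) \<longrightarrow>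
        mpoly_eval c (\<lambda>s. s) P = 0 \<longrightarrow> P = 0)"

definition transcendence_basis :: "('k::field \<Rightarrow> 'f::field) \<Rightarrow> 'f set \<Rightarrow> 'f set \<Rightarrow> bool" where
  "transcendence_basis c K S \<longleftrightarrow>
     S \<subseteq> K \<and> algebraically_independent c S \<and>
     (\<forall>x\<in>K. ring.algebraic ring_of_type_algebra
              (generate_field ring_of_type_algebra (range c \<union> S)) x)"

definition gamma_field_r ::
  "('g, 'x) monoid_scheme \<Rightarrow> ('g \<Rightarrow> 'k::field ^ 'n::{finite,linorder} ^ 'n::{finite,linorder}) \<Rightarrow>
     nat" where
  "gamma_field_r G \<rho> =
     (LEAST d. 0 < d \<and>
        (\<exists>S \<subseteq> {f \<in> invariant_field G \<rho>. ratfun_degree f \<le> d}.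
            transcendence_basis ratfun_const (invariant_field G \<rho>) S))"

text \<open>
  Characters are taken to be extensional, so that distinct elements of this set are distinct as
  homomorphisms on \<open>carrier G\<close>.
\<close>

definition characters :: "('g, 'x) monoid_scheme \<Rightarrow> ('g \<Rightarrow> 'k::field alg_closure) set" where
  "characters G = hom G (mult_of ring_of_type_algebra) \<inter> extensional (carrier G)"

definition occurs_in ::
  "('g, 'x) monoid_scheme \<Rightarrow> ('g \<Rightarrow> 'k::field ^ 'n ^ 'n) \<Rightarrow> ('g \<Rightarrow> 'k alg_closure) \<Rightarrow> bool" where
  "occurs_in G \<rho> \<psi> \<longleftrightarrow>
     (\<exists>v :: 'k alg_closure ^ 'n. v \<noteq> 0 \<and>
        (\<forall>g\<in>carrier G. map_matrix to_ac (\<rho> g) *v v = \<psi> g *s v))"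

definition nontrivial_characters_in ::
  "('g, 'x) monoid_scheme \<Rightarrow> ('g \<Rightarrow> 'k::field ^ 'n ^ 'n) \<Rightarrow> ('g \<Rightarrow> 'k alg_closure) set" where
  "nontrivial_characters_in G \<rho> =
     {\<psi> \<in> characters G. (\<exists>g\<in>carrier G. \<psi> g \<noteq> 1) \<and> occurs_in G \<rho> \<psi>}"

end

theory Submission
  imports Defs "Jordan_Normal_Form.Determinant"
begin

text \<open>
  Over the algebraic closure the matrices \<open>\<rho> g\<close> have a common eigenbasis (\<open>exists_joint_eigenbasis\<close>), so \<open>g\<close>
  multiplies each eigencoordinate by the value at \<open>g\<close> of a character. Let \<open>\<chi>\<^sub>1, \<dots>, \<chi>\<^sub>m\<close> be the nontrivial ones, and
  let the multidegree of a monomial collect, for each \<open>k\<close>, the total exponent \<open>a\<^sub>k\<close> of the eigencoordinates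
  with character \<open>\<chi>\<^sub>k\<close>. Then \<open>g\<close> acts on the monomial by the product of the \<open>\<chi>\<^sub>k(g)\<close> to the powers \<open>a\<^sub>k\<close>.

  An invariant rational function \<open>f\<close> of degree at most \<open>d\<close> is a quotient of two polynomials of total degree
  at most \<open>d\<close> together, all of whose monomials have the same character
  (\<open>semi_invariant_representation\<close>). Hence the multidegree of a monomial of the numerator minus that of a
  monomial of the denominator is a relation \<open>v\<close> between the characters: the product of the \<open>\<chi>\<^sub>k\<close> to the powers \<open>v\<^sub>k\<close> is
  trivial. Its norm \<open>\<bar>v\<^sub>1\<bar> + \<dots> + \<bar>v\<^sub>m\<bar>\<close> is at most \<open>d\<close>.

  Let \<open>f\<close> run through a transcendence basis of the invariants. If the relations obtained in this way did not
  span a space of dimension \<open>m\<close>, a nonzero integer vector would be orthogonal to all of them, and a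
  one-parameter torus, acting nontrivially on the eigencoordinates, would fix the basis. This is
  impossible: all rational functions are algebraic over the field generated by the basis, so each would
  take only finitely many values along the torus
  (\<open>torus_fixing_basis_is_trivial\<close>). So \<open>m\<close> of the relations form an integer matrix \<open>M\<close> with \<open>det M \<noteq> 0\<close>, and \<open>\<bar>det M\<bar>\<close>
  is at most the product of the norms of the rows, hence at most \<open>d\<^sup>m\<close>.

  Finally, the points \<open>(\<chi>\<^sub>1(g), \<dots>, \<chi>\<^sub>m(g))\<close> are distinct, since the representation is faithful, and they all solve
  the monomial equations with exponent matrix \<open>M\<close>. Such a system has at most \<open>\<bar>det M\<bar>\<close> solutions with
  nonzero coordinates (\<open>card_torus_kernel_le_det\<close>), so the order of the group is at most \<open>d\<^sup>m\<close>.
\<close>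

text \<open>The infix \<open>$\<close> is kept for the components of vectors with a finite index type.\<close>

no_notation fps_nth (infixl "$" 75)
no_notation Matrix.vec_index (infixl "$" 100)

section \<open>Counting solutions of monomial equations\<close>

lemma card_powi_roots:
  fixes a :: "'a::field" and c :: int
  assumes "c \<noteq> 0"
  shows "finite {x. x \<noteq> 0 \<and> x powi c = a}"
    and "int (card {x. x \<noteq> 0 \<and> x powi c = a}) \<le> \<bar>c\<bar>"
proof -
  define k where "k = nat \<bar>c\<bar>"
  define b where "b = (if c > 0 then a else inverse a)"
  have k: "k > 0" using assms by (simp add: k_def)
  define p where "p = Polynomial.monom 1 k - [:b:]"
  have deg: "Polynomial.degree p = k"
    unfolding p_def diff_conv_add_uminus
    by (subst Polynomial.degree_add_eq_left) (use k in \<open>auto simp: degree_monom_eq\<close>)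
  have "p \<noteq> 0" using deg k by auto
  have sub: "{x. x \<noteq> 0 \<and> x powi c = a} \<subseteq> {x. poly p x = 0}"
    using assms by (auto simp: p_def poly_monom b_def k_def power_int_def power_inverse)
  show "finite {x. x \<noteq> 0 \<and> x powi c = a}"
    using sub poly_roots_finite[OF \<open>p \<noteq> 0\<close>] by (rule finite_subset)
  have "card {x. x \<noteq> 0 \<and> x powi c = a} \<le> card {x. poly p x = 0}"
    by (rule card_mono[OF poly_roots_finite[OF \<open>p \<noteq> 0\<close>] sub])
  also have "\<dots> \<le> k"
    using card_poly_roots_bound[OF \<open>p \<noteq> 0\<close>] deg by simp
  finally show "int (card {x. x \<noteq> 0 \<and> x powi c = a}) \<le> \<bar>c\<bar>"
    by (simp add: k_def)
qed

lemma prod_powi: "(\<Prod>j\<in>A. f j powi c) = (\<Prod>j\<in>A. f j :: 'a::field) powi c"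
  by (induction A rule: infinite_finite_induct) (auto simp: power_int_mult_distrib)

lemma powi_sum: "t \<noteq> 0 \<Longrightarrow> (t :: 'a::field) powi (\<Sum>j\<in>A. f j) = (\<Prod>j\<in>A. t powi f j)"
  by (induction A rule: infinite_finite_induct) (simp_all add: power_int_add)

text \<open>
  The solutions of \<open>t\<^sup>M = 1\<close> in the algebraic torus, that is, the kernel of the endomorphism of the torus
  with exponent matrix \<open>M\<close>. Points are sequences with the value 1 beyond the last
  column, so that equal points are equal functions and deleting a coordinate is a shift.
\<close>

definition torus_kernel :: "int mat \<Rightarrow> (nat \<Rightarrow> 'a::field) set" where
  "torus_kernel M = {t. (\<forall>j. t j \<noteq> 0) \<and> (\<forall>j\<ge>dim_col M. t j = 1) \<and>
     (\<forall>i<dim_row M. (\<Prod>j<dim_col M. t j powi (M $$ (i, j))) = 1)}"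

text \<open>
  A row operation replaces a relation by a product of relations, so no solution is lost.
\<close>

lemma torus_kernel_addrow:
  assumes "M \<in> carrier_mat n n" "l < n" "k \<noteq> l"
  shows "torus_kernel M \<subseteq> torus_kernel (addrow s k l M)"
proof
  fix t :: "nat \<Rightarrow> 'a" assume t: "t \<in> torus_kernel M"
  have nz: "t j \<noteq> 0" for j using t by (auto simp: torus_kernel_def)
  have "(\<Prod>j<n. t j powi (addrow s k l M $$ (i, j))) = 1" if i: "i < n" for i
  proof (cases "i = k")
    case False
    then have "(\<Prod>j<n. t j powi (addrow s k l M $$ (i, j))) = (\<Prod>j<n. t j powi (M $$ (i, j)))"
      using assms i by (intro prod.cong) auto
    then show ?thesis using t i assms by (auto simp: torus_kernel_def)
  next
    case True
    have "(\<Prod>j<n. t j powi (addrow s k l M $$ (i, j)))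
       = (\<Prod>j<n. (t j powi (M $$ (l, j))) powi s * t j powi (M $$ (i, j)))"
      using assms i True nz
      by (intro prod.cong) (auto simp: power_int_add power_int_mult mult.commute[of s])
    also have "\<dots> = (\<Prod>j<n. t j powi (M $$ (l, j))) powi s * (\<Prod>j<n. t j powi (M $$ (i, j)))"
      by (simp add: prod.distrib prod_powi)
    also have "\<dots> = 1"
      using t i assms by (auto simp: torus_kernel_def)
    finally show ?thesis .
  qed
  then show "t \<in> torus_kernel (addrow s k l M)"
    using t assms by (auto simp: torus_kernel_def)
qed

text \<open>
  Expansion along a first column with a single nonzero entry \<open>c\<close>, in row \<open>r\<close>: the other rows do not
  involve \<open>t\<^sub>0\<close> and constrain the remaining coordinates through the minor; once these are chosen,
  row \<open>r\<close> reads \<open>t\<^sub>0\<^sup>c = const\<close> and leaves at most \<open>\<bar>c\<bar>\<close> possibilities.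
\<close>

lemma card_torus_kernel_expand:
  fixes M :: "int mat"
  assumes M: "M \<in> carrier_mat (Suc n) (Suc n)" and r: "r < Suc n"
    and c: "M $$ (r, 0) \<noteq> 0"
    and zero: "\<And>i. i < Suc n \<Longrightarrow> i \<noteq> r \<Longrightarrow> M $$ (i, 0) = 0"
    and fin: "finite (torus_kernel (mat_delete M r 0) :: (nat \<Rightarrow> 'a::field) set)"
  shows "finite (torus_kernel M :: (nat \<Rightarrow> 'a) set)"
    and "int (card (torus_kernel M :: (nat \<Rightarrow> 'a) set)) \<le>
           \<bar>M $$ (r, 0)\<bar> * int (card (torus_kernel (mat_delete M r 0) :: (nat \<Rightarrow> 'a) set))"
proof -
  let ?K = "torus_kernel M :: (nat \<Rightarrow> 'a) set"
  let ?K' = "torus_kernel (mat_delete M r 0) :: (nat \<Rightarrow> 'a) set"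
  let ?R = "\<lambda>u. {x :: 'a. x \<noteq> 0 \<and> x powi (M $$ (r, 0)) = inverse (\<Prod>j<n. u j powi (M $$ (r, Suc j)))}"
  have sub: "?K \<subseteq> (\<Union>u\<in>?K'. (\<lambda>x. case_nat x u) ` ?R u)"
  proof
    fix t assume t: "t \<in> ?K"
    define u where "u = (\<lambda>j. t (Suc j))"
    have nz: "t j \<noteq> 0" for j using t by (auto simp: torus_kernel_def)
    have row: "(\<Prod>j<Suc n. t j powi (M $$ (i, j))) = 1" if "i < Suc n" for i
      using t that M by (auto simp: torus_kernel_def)
    have row': "t 0 powi (M $$ (i, 0)) * (\<Prod>j<n. u j powi (M $$ (i, Suc j))) = 1"
      if "i < Suc n" for i
      using row[OF that] by (simp add: prod.lessThan_Suc_shift u_def del: prod.lessThan_Suc)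
    have "u \<in> ?K'"
    proof -
      have "(\<Prod>j<n. u j powi (mat_delete M r 0 $$ (i, j))) = 1" if i: "i < n" for i
      proof -
        define i' where "i' = (if i < r then i else Suc i)"
        have i': "i' < Suc n" "i' \<noteq> r" using i by (auto simp: i'_def)
        have "(\<Prod>j<n. u j powi (mat_delete M r 0 $$ (i, j))) = (\<Prod>j<n. u j powi (M $$ (i', Suc j)))"
          using M i by (intro prod.cong) (auto simp: mat_delete_def i'_def)
        then show ?thesis using row'[OF i'(1)] zero[OF i'] by simp
      qed
      then show ?thesis using t M by (auto simp: torus_kernel_def u_def nz)
    qed
    moreover have "t = case_nat (t 0) u"
      by (rule ext) (auto simp: u_def split: nat.split)
    moreover have "t 0 \<in> ?R u"
      using row'[OF r] nz by (auto simp: field_simps u_def inverse_unique)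
    ultimately show "t \<in> (\<Union>u\<in>?K'. (\<lambda>x. case_nat x u) ` ?R u)" by blast
  qed
  have finR: "finite (?R u)" for u by (rule card_powi_roots(1)[OF c])
  have finU: "finite (\<Union>u\<in>?K'. (\<lambda>x. case_nat x u) ` ?R u)"
    using fin finR by blast
  show "finite ?K" using sub finU by (rule finite_subset)
  have "card ?K \<le> card (\<Union>u\<in>?K'. (\<lambda>x. case_nat x u) ` ?R u)"
    by (rule card_mono[OF finU sub])
  also have "\<dots> \<le> (\<Sum>u\<in>?K'. card ((\<lambda>x. case_nat x u) ` ?R u))"
    by (rule card_UN_le[OF fin])
  also have "\<dots> \<le> (\<Sum>u\<in>?K'. nat \<bar>M $$ (r, 0)\<bar>)"
  proof (rule sum_mono)
    fix u
    have "card ((\<lambda>x. case_nat x u) ` ?R u) \<le> card (?R u)" by (rule card_image_le[OF finR])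
    also have "\<dots> \<le> nat \<bar>M $$ (r, 0)\<bar>"
      using card_powi_roots(2)[OF c, of "inverse (\<Prod>j<n. u j powi (M $$ (r, Suc j)))"] by linarith
    finally show "card ((\<lambda>x. case_nat x u) ` ?R u) \<le> nat \<bar>M $$ (r, 0)\<bar>" .
  qed
  finally have "card ?K \<le> card ?K' * nat \<bar>M $$ (r, 0)\<bar>" by simp
  then have "int (card ?K) \<le> int (card ?K' * nat \<bar>M $$ (r, 0)\<bar>)" by (simp only: of_nat_le_iff)
  then show "int (card ?K) \<le> \<bar>M $$ (r, 0)\<bar> * int (card ?K')" by (simp add: mult.commute)
qed

text \<open>
  Over the complex numbers the kernel has exactly \<open>\<bar>det M\<bar>\<close> elements; over any field this is an upper
  bound. The Euclidean algorithm on the first column keeps \<open>\<bar>det M\<bar>\<close> and does not shrink the solution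
  set; it ends with a column that has one nonzero entry, along which both sides are expanded.
\<close>

lemma card_torus_kernel_le_det:
  fixes M :: "int mat"
  assumes "M \<in> carrier_mat n n" "det M \<noteq> 0"
  shows "finite (torus_kernel M :: (nat \<Rightarrow> 'a::field) set)
       \<and> int (card (torus_kernel M :: (nat \<Rightarrow> 'a) set)) \<le> \<bar>det M\<bar>"
  using assms
proof (induction n arbitrary: M)
  case 0
  have "torus_kernel M \<subseteq> {\<lambda>_. 1 :: 'a}" using 0 by (auto simp: torus_kernel_def)
  then show ?case using 0 by (auto dest: finite_subset card_mono[rotated])
next
  case (Suc n)
  note IHn = Suc.IH
  show ?case using Suc.prems
  proof (induction "\<Sum>i<Suc n. nat \<bar>M $$ (i, 0)\<bar>" arbitrary: M rule: less_induct)
    case less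
    note M = less.prems(1)
    show ?case
    proof (cases "\<exists>k l. k < Suc n \<and> l < Suc n \<and> k \<noteq> l \<and> M $$ (l, 0) \<noteq> 0 \<and> \<bar>M $$ (l, 0)\<bar> \<le> \<bar>M $$ (k, 0)\<bar>")
      case True
      then obtain k l where kl: "k < Suc n" "l < Suc n" "k \<noteq> l" "M $$ (l, 0) \<noteq> 0"
        "\<bar>M $$ (l, 0)\<bar> \<le> \<bar>M $$ (k, 0)\<bar>" by blast
      \<comment> \<open>One subtraction step of the Euclidean algorithm: the sign makes the larger entry
          shrink by the absolute value of the smaller one.\<close>
      define s where "s = - (sgn (M $$ (k, 0)) * sgn (M $$ (l, 0)))"
      define M' where "M' = addrow s k l M"
      have M': "M' \<in> carrier_mat (Suc n) (Suc n)" using M by (simp add: M'_def)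
      have det: "det M' = det M" unfolding M'_def by (rule det_addrow[OF kl(2,3) M])
      have k0: "\<bar>M' $$ (k, 0)\<bar> < \<bar>M $$ (k, 0)\<bar>"
        using kl M by (auto simp: M'_def s_def sgn_if)
      have others: "M' $$ (i, 0) = M $$ (i, 0)" if "i < Suc n" "i \<noteq> k" for i
        using that M by (auto simp: M'_def)
      have "(\<Sum>i<Suc n. nat \<bar>M' $$ (i, 0)\<bar>) < (\<Sum>i<Suc n. nat \<bar>M $$ (i, 0)\<bar>)"
      proof (rule sum_strict_mono_ex1)
        show "\<forall>i\<in>{..<Suc n}. nat \<bar>M' $$ (i, 0)\<bar> \<le> nat \<bar>M $$ (i, 0)\<bar>"
          using k0 others by (metis lessThan_iff less_imp_le nat_mono order_refl)
        show "\<exists>i\<in>{..<Suc n}. nat \<bar>M' $$ (i, 0)\<bar> < nat \<bar>M $$ (i, 0)\<bar>"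
          using k0 kl(1) by (intro bexI[of _ k]) auto
      qed simp
      from less.hyps[OF this M'] det less.prems(2)
      have IH: "finite (torus_kernel M' :: (nat \<Rightarrow> 'a) set)"
        "int (card (torus_kernel M' :: (nat \<Rightarrow> 'a) set)) \<le> \<bar>det M\<bar>" by auto
      have sub: "(torus_kernel M :: (nat \<Rightarrow> 'a) set) \<subseteq> torus_kernel M'"
        unfolding M'_def by (rule torus_kernel_addrow[OF M kl(2,3)])
      show ?thesis
        using finite_subset[OF sub IH(1)] card_mono[OF IH(1) sub] IH(2) by linarith
    next
      case False
      have lap: "det M = (\<Sum>i<Suc n. M $$ (i, 0) * cofactor M i 0)"
        by (rule laplace_expansion_column[OF M]) simp
      then obtain r where r: "r < Suc n" "M $$ (r, 0) \<noteq> 0"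
        using less.prems(2) by (metis (no_types, lifting) lessThan_iff mult_zero_left sum.neutral)
      have zero: "M $$ (i, 0) = 0" if "i < Suc n" "i \<noteq> r" for i
        using False r that by (metis linorder_linear)
      have "(\<Sum>i<Suc n. M $$ (i, 0) * cofactor M i 0) = (\<Sum>i\<in>{r}. M $$ (i, 0) * cofactor M i 0)"
        using r zero by (intro sum.mono_neutral_right) auto
      then have detM: "\<bar>det M\<bar> = \<bar>M $$ (r, 0)\<bar> * \<bar>det (mat_delete M r 0)\<bar>"
        using lap by (simp add: cofactor_def abs_mult power_abs)
      have D: "mat_delete M r 0 \<in> carrier_mat n n" using mat_delete_carrier[OF M] by simp
      have "det (mat_delete M r 0) \<noteq> 0" using detM less.prems(2) by auto
      from IHn[OF D this]
      have IH: "finite (torus_kernel (mat_delete M r 0) :: (nat \<Rightarrow> 'a) set)"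
        "int (card (torus_kernel (mat_delete M r 0) :: (nat \<Rightarrow> 'a) set)) \<le> \<bar>det (mat_delete M r 0)\<bar>" by auto
      note e = card_torus_kernel_expand[OF M r zero IH(1)]
      show ?thesis
        using e IH(2) detM by (metis abs_ge_zero dual_order.trans mult_left_mono)
    qed
  qed
qed

text \<open>
  Hadamard's inequality for the \<open>\<ell>\<^sub>1\<close>-norm: the product of the row sums, multiplied out, has one summand
  for each map of the index set to itself, and the permutations among them already bound the
  Leibniz formula.
\<close>

lemma abs_det_le_prod_row_sums:
  fixes M :: "int mat"
  assumes M: "M \<in> carrier_mat n n"
  shows "\<bar>det M\<bar> \<le> (\<Prod>i<n. \<Sum>j<n. \<bar>M $$ (i, j)\<bar>)"
proof -
  let ?P = "{p. p permutes {0..<n}}"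
  let ?f = "\<lambda>p. \<Prod>i<n. \<bar>M $$ (i, p i)\<bar>"
  have "\<bar>det M\<bar> \<le> (\<Sum>p\<in>?P. \<bar>signof p * (\<Prod>i=0..<n. M $$ (i, p i))\<bar>)"
    unfolding det_def'[OF M] by (rule sum_abs)
  also have "\<dots> = (\<Sum>p\<in>?P. ?f p)"
    by (intro sum.cong) (auto simp: abs_mult abs_prod sign_def atLeast0LessThan)
  also have "\<dots> = (\<Sum>q\<in>(\<lambda>p. restrict p {..<n}) ` ?P. ?f q)"
  proof (subst sum.reindex)
    show "inj_on (\<lambda>p. restrict p {..<n}) ?P"
    proof (rule inj_onI)
      fix p q assume pq: "p \<in> ?P" "q \<in> ?P" "restrict p {..<n} = restrict q {..<n}"
      show "p = q"
      proof
        fix x show "p x = q x"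
          using pq by (cases "x < n") (metis lessThan_iff restrict_apply', auto simp: permutes_def)
      qed
    qed
  qed (auto intro!: sum.cong prod.cong)
  also have "\<dots> \<le> (\<Sum>q\<in>Pi\<^sub>E {..<n} (\<lambda>_. {..<n}). ?f q)"
    by (rule sum_mono2) (auto intro!: finite_PiE prod_nonneg simp: permutes_def,
        metis permutes_def permutes_in_image atLeastLessThan_iff lessThan_iff zero_le)
  also have "\<dots> = (\<Prod>i<n. \<Sum>j<n. \<bar>M $$ (i, j)\<bar>)"
    by (rule prod_sum_PiE[symmetric]) auto
  finally show ?thesis .
qed

text \<open>
  The hypothesis says that no nonzero integer vector is orthogonal to \<open>D\<close>. Rows are found one at a
  time, keeping the leading \<open>k \<times> k\<close> minor nonzero: as a function of a new row, the next minor is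
  the pairing with its vector of cofactors, and the last cofactor is the previous minor.
\<close>

lemma exists_rows_with_det_nonzero:
  fixes D :: "(nat \<Rightarrow> int) set"
  assumes "\<And>w. \<exists>j<m. w j \<noteq> 0 \<Longrightarrow> \<exists>v\<in>D. (\<Sum>j<m. w j * v j) \<noteq> 0" and "k \<le> m"
  shows "\<exists>v. (\<forall>i<k. v i \<in> D) \<and> det (mat k k (\<lambda>(i, j). v i j)) \<noteq> 0"
  using assms(2)
proof (induction k)
  case 0
  then show ?case by simp
next
  case (Suc k)
  then obtain v where v: "\<forall>i<k. v i \<in> D" "det (mat k k (\<lambda>(i, j). v i j)) \<noteq> 0" by auto
  define N where "N u = mat (Suc k) (Suc k) (\<lambda>(i, j). (v(k := u)) i j)" for u
  define w where "w j = (if j \<le> k then cofactor (N (\<lambda>_. 0)) k j else 0)" for j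
  have N: "N u \<in> carrier_mat (Suc k) (Suc k)" for u by (simp add: N_def)
  have del: "mat_delete (N u) k j = mat_delete (N (\<lambda>_. 0)) k j" for u j
    by (rule eq_matI) (auto simp: mat_delete_def N_def)
  have det: "det (N u) = (\<Sum>j<m. w j * u j)" for u
  proof -
    have "det (N u) = (\<Sum>j<Suc k. N u $$ (k, j) * cofactor (N u) k j)"
      by (rule laplace_expansion_row[OF N]) simp
    also have "\<dots> = (\<Sum>j<Suc k. w j * u j)"
    proof (intro sum.cong refl)
      fix j assume "j \<in> {..<Suc k}"
      then show "N u $$ (k, j) * cofactor (N u) k j = w j * u j"
        by (simp add: w_def cofactor_def del[of u]) (simp add: N_def)
    qed
    also have "\<dots> = (\<Sum>j<m. w j * u j)"
      using Suc.prems by (intro sum.mono_neutral_left) (auto simp: w_def)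
    finally show ?thesis .
  qed
  have "mat_delete (N (\<lambda>_. 0)) k k = mat k k (\<lambda>(i, j). v i j)"
    by (rule eq_matI) (auto simp: mat_delete_def N_def)
  then have "w k \<noteq> 0" using v(2) by (simp add: w_def cofactor_def)
  then have "\<exists>j<m. w j \<noteq> 0" using Suc.prems by (intro exI[of _ k]) auto
  then obtain u where "u \<in> D" "det (N u) \<noteq> 0"
    using assms(1)[of w] det by auto
  then show ?case using v(1)
    by (intro exI[of _ "v(k := u)"]) (auto simp: N_def less_Suc_eq)
qed

text \<open>
  This is how the number \<open>d\<^sup>m\<close> arises: \<open>m\<close> relations of norm at most \<open>d\<close> give an exponent matrix with
  determinant at most \<open>d\<^sup>m\<close>, and this determinant bounds the number of solutions.
\<close>

lemma card_common_solutions_le: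
  fixes D :: "(nat \<Rightarrow> int) set" and T :: "(nat \<Rightarrow> 'a::field) set"
  assumes full: "\<And>w. \<exists>j<m. w j \<noteq> 0 \<Longrightarrow> \<exists>v\<in>D. (\<Sum>j<m. w j * v j) \<noteq> 0"
    and short: "\<And>v. v \<in> D \<Longrightarrow> (\<Sum>j<m. \<bar>v j\<bar>) \<le> int d"
    and T: "\<And>t j. t \<in> T \<Longrightarrow> t j \<noteq> 0" "\<And>t j. t \<in> T \<Longrightarrow> m \<le> j \<Longrightarrow> t j = 1"
    and rel: "\<And>t v. t \<in> T \<Longrightarrow> v \<in> D \<Longrightarrow> (\<Prod>j<m. t j powi v j) = 1"
  shows "card T \<le> d ^ m"
proof -
  obtain v where v: "\<forall>i<m. v i \<in> D" "det (mat m m (\<lambda>(i, j). v i j)) \<noteq> 0"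
    using exists_rows_with_det_nonzero[of m D m, OF full] by auto
  define M where "M = mat m m (\<lambda>(i, j). v i j)"
  have M: "M \<in> carrier_mat m m" by (simp add: M_def)
  have sub: "T \<subseteq> torus_kernel M"
    using T rel v(1) by (auto simp: torus_kernel_def M_def)
  note k = card_torus_kernel_le_det[OF M, where ?'a = 'a]
  have fin: "finite (torus_kernel M :: (nat \<Rightarrow> 'a) set)" and "int (card (torus_kernel M :: (nat \<Rightarrow> 'a) set)) \<le> \<bar>det M\<bar>"
    using k v(2) by (auto simp: M_def)
  with card_mono[OF fin sub] have "int (card T) \<le> \<bar>det M\<bar>" by linarith
  also have "\<dots> \<le> (\<Prod>i<m. \<Sum>j<m. \<bar>M $$ (i, j)\<bar>)" by (rule abs_det_le_prod_row_sums[OF M])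
  also have "\<dots> \<le> (\<Prod>i<m. int d)"
    using short v(1) by (intro prod_mono) (auto simp: M_def intro!: sum_nonneg)
  also have "\<dots> = int (d ^ m)" by simp
  finally show ?thesis by (simp only: of_nat_le_iff)
qed

section \<open>Evaluation and linear substitution of polynomials\<close>

abbreviation monom_eval :: "('n \<Rightarrow> 'b::comm_semiring_1) \<Rightarrow> ('n \<Rightarrow>\<^sub>0 nat) \<Rightarrow> 'b" where
  "monom_eval a m \<equiv> (\<Prod>i\<in>Poly_Mapping.keys m. a i ^ Poly_Mapping.lookup m i)"

abbreviation monom_degree :: "('n \<Rightarrow>\<^sub>0 nat) \<Rightarrow> nat" where
  "monom_degree m \<equiv> (\<Sum>i\<in>Poly_Mapping.keys m. Poly_Mapping.lookup m i)"

lemma monom_eval_superset: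
  assumes "finite A" "Poly_Mapping.keys m \<subseteq> A"
  shows "monom_eval a m = (\<Prod>i\<in>A. a i ^ Poly_Mapping.lookup m i)"
  using assms by (intro prod.mono_neutral_left) (auto simp: in_keys_iff)

lemma monom_degree_superset:
  assumes "finite A" "Poly_Mapping.keys m \<subseteq> A"
  shows "monom_degree m = (\<Sum>i\<in>A. Poly_Mapping.lookup m i)"
  using assms by (intro sum.mono_neutral_left) (auto simp: in_keys_iff)

lemma monom_eval_add: "monom_eval a (m + m') = monom_eval a m * monom_eval a m'"
proof -
  let ?A = "Poly_Mapping.keys m \<union> Poly_Mapping.keys m'"
  have "monom_eval a (m + m') = (\<Prod>i\<in>?A. a i ^ Poly_Mapping.lookup (m + m') i)"
    by (rule monom_eval_superset) (use keys_add[of m m'] in auto)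
  also have "\<dots> = (\<Prod>i\<in>?A. a i ^ Poly_Mapping.lookup m i) * (\<Prod>i\<in>?A. a i ^ Poly_Mapping.lookup m' i)"
    by (simp add: lookup_add power_add prod.distrib)
  also have "\<dots> = monom_eval a m * monom_eval a m'"
    by (simp only: monom_eval_superset[of ?A m, symmetric] monom_eval_superset[of ?A m', symmetric]
        finite_Un finite_keys Un_upper1 Un_upper2)
  finally show ?thesis .
qed

lemma mpoly_eq_sum_monomials:
  "p = (\<Sum>m\<in>Poly_Mapping.keys p. Poly_Mapping.single m (Poly_Mapping.lookup p m))"
proof (rule poly_mapping_eqI)
  fix k
  have "(\<Sum>m\<in>Poly_Mapping.keys p. (Poly_Mapping.lookup p m when m = k)) = Poly_Mapping.lookup p k"
    by (cases "k \<in> Poly_Mapping.keys p") (auto simp: when_def in_keys_iff)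
  then show "Poly_Mapping.lookup p k = Poly_Mapping.lookup
      (\<Sum>m\<in>Poly_Mapping.keys p. Poly_Mapping.single m (Poly_Mapping.lookup p m)) k"
    by (simp add: lookup_sum lookup_single)
qed

lemma mpoly_induct [case_names single add]:
  fixes P :: "('a \<Rightarrow>\<^sub>0 'b::comm_monoid_add) \<Rightarrow> bool"
  assumes single: "\<And>m x. P (Poly_Mapping.single m x)"
    and add: "\<And>p q. P p \<Longrightarrow> P q \<Longrightarrow> P (p + q)"
  shows "P p"
proof -
  have "P (\<Sum>m\<in>A. Poly_Mapping.single m (Poly_Mapping.lookup p m))" if "finite A" for A
    using that
  proof (induction A rule: finite_induct)
    case empty
    show ?case using single[of undefined 0] by simp
  next
    case (insert x F)
    then show ?case using single add by auto
  qed
  then show ?thesis using mpoly_eq_sum_monomials[of p] finite_keys by metis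
qed

lemma mpoly_eval_superset:
  assumes "c 0 = 0" "finite A" "Poly_Mapping.keys p \<subseteq> A"
  shows "mpoly_eval c a p = (\<Sum>m\<in>A. c (Poly_Mapping.lookup p m) * monom_eval a m)"
  unfolding mpoly_eval_def
  using assms by (intro sum.mono_neutral_left) (auto simp: in_keys_iff)

lemma mpoly_eval_single:
  assumes "c 0 = 0"
  shows "mpoly_eval c a (Poly_Mapping.single m x) = c x * monom_eval a m"
  using assms by (simp add: mpoly_eval_def)

lemma mpoly_eval_add:
  assumes "comm_ring_hom c"
  shows "mpoly_eval c a (p + q) = mpoly_eval c a p + mpoly_eval c a q"
proof -
  interpret comm_ring_hom c by fact
  let ?A = "Poly_Mapping.keys p \<union> Poly_Mapping.keys q"
  have *: "mpoly_eval c a r = (\<Sum>m\<in>?A. c (Poly_Mapping.lookup r m) * monom_eval a m)"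
    if "Poly_Mapping.keys r \<subseteq> ?A" for r
    using that by (intro mpoly_eval_superset) auto
  show ?thesis
    using keys_add[of p q]
    by (simp add: * lookup_add hom_add distrib_right sum.distrib)
qed

lemma comm_ring_hom_mpoly_eval:
  assumes "comm_ring_hom c"
  shows "comm_ring_hom (mpoly_eval c a)"
proof -
  interpret c: comm_ring_hom c by fact
  note add = mpoly_eval_add[OF assms, of a]
  have mult1: "mpoly_eval c a (Poly_Mapping.single m x * q) = mpoly_eval c a (Poly_Mapping.single m x) * mpoly_eval c a q"
    for m x q
  proof (induction q rule: mpoly_induct)
    case (single m' y)
    show ?case by (simp add: mult_single mpoly_eval_single monom_eval_add c.hom_mult mult_ac)
  next
    case (add p q)
    then show ?case by (simp only: distrib_left mpoly_eval_add[OF assms])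
  qed
  have mult: "mpoly_eval c a (p * q) = mpoly_eval c a p * mpoly_eval c a q" for p q
    by (induction p rule: mpoly_induct) (simp_all only: mult1 add distrib_right)
  show ?thesis
    by standard (use mpoly_eval_single[of c a 0 1] mpoly_eval_single[of c a 0 0] in \<open>simp_all add: add mult\<close>)
qed

lemma single_eq_prod_vars:
  "Poly_Mapping.single m (x :: 'k::comm_semiring_1) = mpoly_const x * monom_eval mpoly_var m"
proof -
  have *: "(\<Prod>i\<in>A. (mpoly_var i :: ('n, 'k) mpoly) ^ f i)
        = Poly_Mapping.single (\<Sum>i\<in>A. Poly_Mapping.single i (f i)) 1" for A and f :: "'n \<Rightarrow> nat"
  proof (induction A rule: infinite_finite_induct)
    case (insert i A)
    have pow: "(mpoly_var i :: ('n, 'k) mpoly) ^ k = Poly_Mapping.single (Poly_Mapping.single i k) 1" for k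
      by (induction k) (simp_all add: mpoly_var_def mult_single single_add[symmetric])
    show ?case using insert by (simp add: pow mult_single)
  qed simp_all
  show ?thesis
    unfolding * mpoly_eq_sum_monomials[of m, symmetric] by (simp add: mpoly_const_def mult_single)
qed

text \<open>
  The universal property of the polynomial ring; equalities between compositions of substitutions
  are reduced by it to constants and variables.
\<close>

lemma mpoly_hom_eq_eval:
  fixes h :: "('n, 'k::comm_ring_1) mpoly \<Rightarrow> 'b::comm_ring_1"
  assumes "comm_ring_hom h"
  shows "h p = mpoly_eval (\<lambda>x. h (mpoly_const x)) (\<lambda>i. h (mpoly_var i)) p"
proof -
  interpret comm_ring_hom h by fact
  have "h p = (\<Sum>m\<in>Poly_Mapping.keys p. h (Poly_Mapping.single m (Poly_Mapping.lookup p m)))"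
    by (subst mpoly_eq_sum_monomials[of p]) (rule hom_sum)
  then show ?thesis
    by (simp add: single_eq_prod_vars hom_mult hom_prod hom_power mpoly_eval_def)
qed

lemma mpoly_hom_ext:
  fixes h :: "('n, 'k::comm_ring_1) mpoly \<Rightarrow> 'b::comm_ring_1"
  assumes "comm_ring_hom h" "comm_ring_hom h'"
    and "\<And>x. h (mpoly_const x) = h' (mpoly_const x)"
    and "\<And>i. h (mpoly_var i) = h' (mpoly_var i)"
  shows "h = h'"
proof
  fix p
  show "h p = h' p"
    unfolding mpoly_hom_eq_eval[OF assms(1), of p] mpoly_hom_eq_eval[OF assms(2), of p] assms(3,4) ..
qed

lemma comm_ring_hom_mpoly_const: "comm_ring_hom (mpoly_const :: 'k::comm_ring_1 \<Rightarrow> ('n, 'k) mpoly)"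
proof
  fix x y :: 'k
  show "mpoly_const (x + y) = (mpoly_const x + mpoly_const y :: ('n, 'k) mpoly)"
    unfolding mpoly_const_def by (rule single_add)
  show "mpoly_const (x * y) = (mpoly_const x * mpoly_const y :: ('n, 'k) mpoly)"
    unfolding mpoly_const_def by (simp add: mult_single)
qed (simp_all add: mpoly_const_def)

lemma mpoly_eval_const:
  assumes "c 0 = 0"
  shows "mpoly_eval c a (mpoly_const x) = c x"
  using mpoly_eval_single[of c a 0 x] assms by (simp add: mpoly_const_def)

lemma mpoly_eval_var:
  assumes "c 0 = 0" "c 1 = 1"
  shows "mpoly_eval c a (mpoly_var i) = a i"
  using assms by (simp add: mpoly_var_def mpoly_eval_single)

lemma comm_ring_hom_compose:
  assumes "comm_ring_hom f" "comm_ring_hom g"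
  shows "comm_ring_hom (\<lambda>x. f (g x))"
proof -
  interpret f: comm_ring_hom f by fact
  interpret g: comm_ring_hom g by fact
  show ?thesis by standard (simp_all only: f.hom_add g.hom_add f.hom_mult g.hom_mult
        f.hom_zero g.hom_zero f.hom_one g.hom_one)
qed

lemma comm_ring_hom_mpoly_subst: "comm_ring_hom (mpoly_subst A)"
  unfolding mpoly_subst_def by (intro comm_ring_hom_mpoly_eval comm_ring_hom_mpoly_const)

lemma mpoly_subst_const [simp]: "mpoly_subst A (mpoly_const x) = mpoly_const x"
  unfolding mpoly_subst_def by (rule mpoly_eval_const) (simp add: mpoly_const_def)

lemma mpoly_const_1: "mpoly_const 1 = 1" and mpoly_const_0: "mpoly_const 0 = 0"
  by (simp_all add: mpoly_const_def)

lemma mpoly_subst_var: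
  "mpoly_subst A (mpoly_var i) = (\<Sum>j\<in>UNIV. mpoly_const (A $ i $ j) * mpoly_var j)"
  unfolding mpoly_subst_def by (rule mpoly_eval_var) (simp_all add: mpoly_const_def)

lemma mpoly_subst_subst:
  fixes A B :: "'k::field ^ 'n::{finite,linorder} ^ 'n::{finite,linorder}"
  shows "mpoly_subst A (mpoly_subst B p) = mpoly_subst (B ** A) p"
proof -
  interpret A: comm_ring_hom "mpoly_subst A" by (rule comm_ring_hom_mpoly_subst)
  interpret c: comm_ring_hom "mpoly_const :: 'k \<Rightarrow> ('n, 'k) mpoly" by (rule comm_ring_hom_mpoly_const)
  have "(\<lambda>p. mpoly_subst A (mpoly_subst B p)) = mpoly_subst (B ** A)"
  proof (rule mpoly_hom_ext)
    fix i
    have "mpoly_subst A (mpoly_subst B (mpoly_var i))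
        = (\<Sum>j\<in>UNIV. \<Sum>k\<in>UNIV. mpoly_const (B $ i $ j * A $ j $ k) * mpoly_var k)"
      by (simp add: mpoly_subst_var A.hom_sum A.hom_mult c.hom_mult sum_distrib_left mult_ac)
    also have "\<dots> = mpoly_subst (B ** A) (mpoly_var i)"
      by (subst sum.swap) (simp add: mpoly_subst_var matrix_matrix_mult_def c.hom_sum sum_distrib_right)
    finally show "mpoly_subst A (mpoly_subst B (mpoly_var i)) = mpoly_subst (B ** A) (mpoly_var i)" .
  qed (auto intro: comm_ring_hom_mpoly_subst comm_ring_hom_compose)
  then show ?thesis by metis
qed

lemma mpoly_subst_mat_1:
  fixes p :: "('n::{finite,linorder}, 'k::field) mpoly"
  shows "mpoly_subst (Finite_Cartesian_Product.mat 1) p = p"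
proof -
  have "mpoly_subst (Finite_Cartesian_Product.mat 1) = (\<lambda>p :: ('n, 'k) mpoly. p)"
  proof (rule mpoly_hom_ext)
    fix i
    have "(\<Sum>j\<in>UNIV. mpoly_const ((Finite_Cartesian_Product.mat 1 :: 'k ^ 'n::{finite,linorder} ^ 'n::{finite,linorder}) $ i $ j) * mpoly_var j)
        = (\<Sum>j\<in>UNIV. if i = j then mpoly_var j else 0)"
      by (intro sum.cong) (auto simp: Finite_Cartesian_Product.mat_def mpoly_const_1 mpoly_const_0)
    then show "mpoly_subst (Finite_Cartesian_Product.mat 1 :: 'k ^ 'n::{finite,linorder} ^ 'n::{finite,linorder}) (mpoly_var i) = mpoly_var i"
      by (simp add: mpoly_subst_var)
  qed (auto intro: comm_ring_hom_mpoly_subst, standard, auto)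
  then show ?thesis by metis
qed

lemma inj_mpoly_subst:
  assumes "invertible A"
  shows "inj (mpoly_subst A)"
proof -
  obtain B where "A ** B = Finite_Cartesian_Product.mat 1" using assms unfolding invertible_def by blast
  then have "mpoly_subst B (mpoly_subst A p) = p" for p
    by (simp add: mpoly_subst_subst mpoly_subst_mat_1)
  then show ?thesis by (metis injI)
qed

definition diagonal_of :: "('n \<Rightarrow> 'k::zero) \<Rightarrow> 'k ^ 'n ^ 'n" where
  "diagonal_of d = (\<chi> i j. if i = j then d i else 0)"

text \<open>
  A diagonal substitution multiplies each monomial by a scalar, so no new
  monomials appear. Everything about the action in eigencoordinates is read off from this.
\<close>

lemma lookup_mpoly_subst_diag:
  fixes d :: "'n::{finite,linorder} \<Rightarrow> 'k::field"
  shows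
  "Poly_Mapping.lookup (mpoly_subst (diagonal_of d) p) m = Poly_Mapping.lookup p m * monom_eval d m"
proof (induction p rule: mpoly_induct)
  case (single m' x)
  interpret c: comm_ring_hom "mpoly_const :: 'k \<Rightarrow> ('n, 'k) mpoly" by (rule comm_ring_hom_mpoly_const)
  have lin: "(\<Sum>j\<in>UNIV. mpoly_const ((diagonal_of d) $ i $ j) * mpoly_var j) = mpoly_const (d i) * mpoly_var i" for i
  proof -
    have "(\<Sum>j\<in>UNIV. mpoly_const ((diagonal_of d) $ i $ j) * mpoly_var j)
        = (\<Sum>j\<in>UNIV. if i = j then mpoly_const (d i) * mpoly_var j else 0)"
      by (intro sum.cong) (auto simp: diagonal_of_def mpoly_const_0)
    then show ?thesis by simp
  qed
  have "mpoly_subst (diagonal_of d) (Poly_Mapping.single m' x)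
      = mpoly_const x * (monom_eval (\<lambda>i. mpoly_const (d i)) m' * monom_eval mpoly_var m')"
    by (simp add: mpoly_subst_def lin mpoly_eval_single mpoly_const_0 power_mult_distrib prod.distrib)
  also have "\<dots> = mpoly_const (x * monom_eval d m') * monom_eval mpoly_var m'"
    by (simp add: c.hom_mult c.hom_prod c.hom_power mult_ac)
  also have "\<dots> = Poly_Mapping.single m' (x * monom_eval d m')"
    by (rule single_eq_prod_vars[symmetric])
  finally show ?case by (auto simp: lookup_single when_def)
next
  case (add p q)
  interpret A: comm_ring_hom "mpoly_subst (diagonal_of d)" by (rule comm_ring_hom_mpoly_subst)
  show ?case using add by (simp add: A.hom_add lookup_add distrib_right)
qed

definition mpoly_map :: "('k \<Rightarrow> 'l) \<Rightarrow> ('n, 'k::comm_ring_1) mpoly \<Rightarrow> ('n, 'l::comm_ring_1) mpoly" where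
  "mpoly_map h = mpoly_eval (\<lambda>x. mpoly_const (h x)) mpoly_var"

lemma comm_ring_hom_mpoly_map:
  assumes "comm_ring_hom h"
  shows "comm_ring_hom (mpoly_map h)"
  unfolding mpoly_map_def
  by (intro comm_ring_hom_mpoly_eval comm_ring_hom_compose[OF comm_ring_hom_mpoly_const assms])

lemma lookup_mpoly_map:
  assumes "comm_ring_hom h"
  shows "Poly_Mapping.lookup (mpoly_map h p) m = h (Poly_Mapping.lookup p m)"
proof -
  interpret h: comm_ring_hom h by fact
  interpret H: comm_ring_hom "mpoly_map h" by (rule comm_ring_hom_mpoly_map[OF assms])
  show ?thesis
  proof (induction p rule: mpoly_induct)
    case (single m' x)
    have "mpoly_map h (Poly_Mapping.single m' x) = Poly_Mapping.single m' (h x)"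
      unfolding mpoly_map_def by (subst mpoly_eval_single) (simp_all add: mpoly_const_0 single_eq_prod_vars)
    then show ?case by (simp add: lookup_single when_def)
  next
    case (add p q)
    then show ?case by (simp add: H.hom_add lookup_add h.hom_add)
  qed
qed

lemma mpoly_map_const:
  assumes "comm_ring_hom h"
  shows "mpoly_map h (mpoly_const x) = mpoly_const (h x)"
proof -
  interpret h: comm_ring_hom h by fact
  show ?thesis unfolding mpoly_map_def by (rule mpoly_eval_const) (simp add: mpoly_const_0)
qed

lemma mpoly_map_var:
  assumes "comm_ring_hom h"
  shows "mpoly_map h (mpoly_var i) = mpoly_var i"
proof -
  interpret h: comm_ring_hom h by fact
  show ?thesis unfolding mpoly_map_def by (rule mpoly_eval_var) (simp_all add: mpoly_const_0 mpoly_const_1)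
qed

lemma mpoly_map_subst:
  fixes A :: "'k::field ^ 'n::{finite,linorder} ^ 'n::{finite,linorder}" and h :: "'k \<Rightarrow> 'l::field"
  assumes "comm_ring_hom h"
  shows "mpoly_map h (mpoly_subst A p) = mpoly_subst (map_matrix h A) (mpoly_map h p)"
proof -
  interpret H: comm_ring_hom "mpoly_map h :: ('n, 'k) mpoly \<Rightarrow> ('n, 'l) mpoly"
    by (rule comm_ring_hom_mpoly_map[OF assms])
  have "(\<lambda>p. mpoly_map h (mpoly_subst A p)) = (\<lambda>p. mpoly_subst (map_matrix h A) (mpoly_map h p))"
  proof (rule mpoly_hom_ext)
    show "comm_ring_hom (\<lambda>p. mpoly_map h (mpoly_subst A p))"
      by (rule comm_ring_hom_compose[OF comm_ring_hom_mpoly_map[OF assms] comm_ring_hom_mpoly_subst])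
    show "comm_ring_hom (\<lambda>p. mpoly_subst (map_matrix h A) (mpoly_map h p))"
      by (rule comm_ring_hom_compose[OF comm_ring_hom_mpoly_subst comm_ring_hom_mpoly_map[OF assms]])
    show "mpoly_map h (mpoly_subst A (mpoly_const x)) = mpoly_subst (map_matrix h A) (mpoly_map h (mpoly_const x))" for x
      by (simp add: mpoly_map_const[OF assms])
    show "mpoly_map h (mpoly_subst A (mpoly_var i)) = mpoly_subst (map_matrix h A) (mpoly_map h (mpoly_var i))" for i
      by (simp add: mpoly_map_const[OF assms] mpoly_map_var[OF assms] mpoly_subst_var H.hom_sum H.hom_mult)
  qed
  then show ?thesis by metis
qed

section \<open>Total degree and reduced fractions\<close>

lemma mpoly_degree_le_iff: "mpoly_degree p \<le> d \<longleftrightarrow> (\<forall>m\<in>Poly_Mapping.keys p. monom_degree m \<le> d)"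
  unfolding mpoly_degree_def by (subst Max_le_iff) auto

lemma monom_degree_le: "m \<in> Poly_Mapping.keys p \<Longrightarrow> monom_degree m \<le> mpoly_degree p"
  using mpoly_degree_le_iff by blast

lemma mpoly_degree_add_le: "mpoly_degree (p + q) \<le> max (mpoly_degree p) (mpoly_degree q)"
  using keys_add[of p q] unfolding mpoly_degree_le_iff
  by (metis UnE in_mono le_max_iff_disj monom_degree_le)

lemma mpoly_degree_sum_le:
  assumes "\<And>x. x \<in> A \<Longrightarrow> mpoly_degree (f x) \<le> d"
  shows "mpoly_degree (sum f A) \<le> d"
  using assms
proof (induction A rule: infinite_finite_induct)
  case (insert x F)
  then show ?case using mpoly_degree_add_le[of "f x" "sum f F"] by fastforce
qed (simp_all add: mpoly_degree_def)

text \<open>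
  The substitution \<open>x\<^sub>i \<mapsto> x\<^sub>i T\<close> for a new variable \<open>T\<close>. It turns the total degree into the degree in \<open>T\<close>,
  so that additivity of the total degree is inherited from univariate polynomials.
\<close>

definition homogenisation :: "('n, 'k::comm_ring_1) mpoly \<Rightarrow> ('n, 'k) mpoly Polynomial.poly" where
  "homogenisation = mpoly_eval (\<lambda>x. [:mpoly_const x:]) (\<lambda>i. Polynomial.monom (mpoly_var i) 1)"

lemma comm_ring_hom_homogenisation:
  "comm_ring_hom (homogenisation :: ('n, 'k::comm_ring_1) mpoly \<Rightarrow> ('n, 'k) mpoly Polynomial.poly)"
proof -
  interpret c: comm_ring_hom "mpoly_const :: 'k \<Rightarrow> ('n, 'k) mpoly" by (rule comm_ring_hom_mpoly_const)
  have "comm_ring_hom (\<lambda>x :: 'k. [:mpoly_const x :: ('n, 'k) mpoly:])"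
    by standard (simp_all add: mpoly_const_0 mpoly_const_1 c.hom_add c.hom_mult)
  then show ?thesis unfolding homogenisation_def by (rule comm_ring_hom_mpoly_eval)
qed

lemma coeff_homogenisation:
  fixes p :: "('n, 'k::comm_ring_1) mpoly"
  shows
  "Poly_Mapping.lookup (Polynomial.coeff (homogenisation p) e) m
     = (if monom_degree m = e then Poly_Mapping.lookup p m else 0)"
proof (induction p rule: mpoly_induct)
  case (single m' x)
  have *: "(\<Prod>i\<in>A. Polynomial.monom (f i) (Suc 0) ^ g i) = Polynomial.monom (\<Prod>i\<in>A. f i ^ g i) (\<Sum>i\<in>A. g i)"
    for A :: "'n set" and f :: "'n \<Rightarrow> ('n, 'k) mpoly" and g
    by (induction A rule: infinite_finite_induct) (simp_all add: monom_power mult_monom)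
  have "homogenisation (Poly_Mapping.single m' x) = [:mpoly_const x:] * Polynomial.monom (monom_eval mpoly_var m') (monom_degree m')"
    unfolding homogenisation_def by (subst mpoly_eval_single) (simp_all add: mpoly_const_0 *)
  also have "\<dots> = Polynomial.monom (Poly_Mapping.single m' x) (monom_degree m')"
    by (simp add: smult_monom single_eq_prod_vars)
  finally show ?case by (auto simp: lookup_single when_def)
next
  case (add p q)
  interpret H: comm_ring_hom "homogenisation :: ('n, 'k) mpoly \<Rightarrow> _" by (rule comm_ring_hom_homogenisation)
  show ?case using add by (simp add: H.hom_add lookup_add)
qed

lemma degree_homogenisation: "Polynomial.degree (homogenisation p) = mpoly_degree p"
proof (rule antisym)
  show "Polynomial.degree (homogenisation p) \<le> mpoly_degree p"
  proof (rule Polynomial.degree_le, intro allI impI poly_mapping_eqI)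
    fix i m assume "mpoly_degree p < i"
    then show "Poly_Mapping.lookup (Polynomial.coeff (homogenisation p) i) m = Poly_Mapping.lookup 0 m"
      using monom_degree_le[of m p] by (cases "m \<in> Poly_Mapping.keys p") (auto simp: coeff_homogenisation in_keys_iff)
  qed
  show "mpoly_degree p \<le> Polynomial.degree (homogenisation p)"
    unfolding mpoly_degree_le_iff
  proof
    fix m assume m: "m \<in> Poly_Mapping.keys p"
    have "Poly_Mapping.lookup (Polynomial.coeff (homogenisation p) (monom_degree m)) m \<noteq> 0"
      using m by (simp add: coeff_homogenisation in_keys_iff)
    then have "Polynomial.coeff (homogenisation p) (monom_degree m) \<noteq> 0" by auto
    then show "monom_degree m \<le> Polynomial.degree (homogenisation p)" by (rule le_degree)
  qed
qed

lemma homogenisation_eq_0_iff: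
  fixes p :: "('n, 'k::comm_ring_1) mpoly"
  shows "homogenisation p = 0 \<longleftrightarrow> p = 0"
proof
  assume h: "homogenisation p = 0"
  show "p = 0"
  proof (rule poly_mapping_eqI)
    fix m
    show "Poly_Mapping.lookup p m = Poly_Mapping.lookup 0 m"
      using coeff_homogenisation[of p "monom_degree m" m] h by simp
  qed
next
  interpret H: comm_ring_hom "homogenisation :: ('n, 'k) mpoly \<Rightarrow> _" by (rule comm_ring_hom_homogenisation)
  show "p = 0 \<Longrightarrow> homogenisation p = 0" by simp
qed

lemma mpoly_degree_mult:
  fixes p q :: "('n::linorder, 'k::idom) mpoly"
  assumes "p \<noteq> 0" "q \<noteq> 0"
  shows "mpoly_degree (p * q) = mpoly_degree p + mpoly_degree q"
proof -
  interpret H: comm_ring_hom "homogenisation :: ('n, 'k) mpoly \<Rightarrow> _" by (rule comm_ring_hom_homogenisation)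
  show ?thesis
    using assms by (simp add: degree_homogenisation[symmetric] H.hom_mult degree_mult_eq homogenisation_eq_0_iff)
qed

lemma mpoly_degree_mult_le:
  fixes p q :: "('n::linorder, 'k::idom) mpoly"
  shows "mpoly_degree (p * q) \<le> mpoly_degree p + mpoly_degree q"
  using mpoly_degree_mult[of p q] by (cases "p = 0 \<or> q = 0") (auto simp: mpoly_degree_def)

lemma mpoly_degree_const: "mpoly_degree (mpoly_const x) = 0"
  by (simp add: mpoly_degree_def mpoly_const_def)

lemma mpoly_degree_1: "mpoly_degree (1 :: ('n, 'k::comm_semiring_1) mpoly) = 0"
  by (simp add: mpoly_degree_def)

lemma mpoly_degree_var: "mpoly_degree (mpoly_var i :: ('n, 'k::zero_neq_one) mpoly) = 1"
  by (simp add: mpoly_degree_def mpoly_var_def)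

lemma mpoly_degree_0_imp_const:
  assumes "mpoly_degree p = 0"
  shows "p = mpoly_const (Poly_Mapping.lookup p 0)"
proof (rule poly_mapping_eqI)
  fix m
  have "m = 0" if "m \<in> Poly_Mapping.keys p"
  proof -
    have "monom_degree m = 0" using monom_degree_le[OF that] assms by simp
    then show ?thesis by (intro poly_mapping_eqI) (auto simp: in_keys_iff)
  qed
  then show "Poly_Mapping.lookup p m = Poly_Mapping.lookup (mpoly_const (Poly_Mapping.lookup p 0)) m"
    by (cases "m \<in> Poly_Mapping.keys p") (auto simp: mpoly_const_def lookup_single when_def in_keys_iff)
qed

lemma mpoly_degree_monom_eval_le:
  fixes f :: "'i \<Rightarrow> ('n::linorder, 'k::idom) mpoly"
  assumes "\<And>i. mpoly_degree (f i) \<le> 1"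
  shows "mpoly_degree (monom_eval f m) \<le> monom_degree m"
proof -
  have pow: "mpoly_degree (f i ^ k) \<le> k" for i k
  proof (induction k)
    case 0
    then show ?case by (simp add: mpoly_degree_1)
  next
    case (Suc k)
    then show ?case using mpoly_degree_mult_le[of "f i" "f i ^ k"] assms[of i] by simp
  qed
  have "mpoly_degree (\<Prod>i\<in>A. f i ^ g i) \<le> (\<Sum>i\<in>A. g i)" for A and g :: "'i \<Rightarrow> nat"
  proof (induction A rule: infinite_finite_induct)
    case (insert x F)
    then show ?case
      using mpoly_degree_mult_le[of "f x ^ g x" "\<Prod>i\<in>F. f i ^ g i"] pow[of x "g x"] by simp
  qed (simp_all add: mpoly_degree_1)
  then show ?thesis .
qed

lemma mpoly_degree_subst_le: "mpoly_degree (mpoly_subst A p) \<le> mpoly_degree p"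
  unfolding mpoly_subst_def mpoly_eval_def
proof (rule mpoly_degree_sum_le)
  fix m assume m: "m \<in> Poly_Mapping.keys p"
  let ?l = "\<lambda>i. \<Sum>j\<in>UNIV. mpoly_const (A $ i $ j) * mpoly_var j"
  have "mpoly_degree (?l i) \<le> 1" for i
  proof (rule mpoly_degree_sum_le)
    fix j
    show "mpoly_degree (mpoly_const (A $ i $ j) * mpoly_var j) \<le> 1"
      using mpoly_degree_mult_le[of "mpoly_const (A $ i $ j)" "mpoly_var j"]
      by (simp add: mpoly_degree_const mpoly_degree_var)
  qed
  from mpoly_degree_monom_eval_le[of ?l m, OF this]
  have "mpoly_degree (mpoly_const (Poly_Mapping.lookup p m) * monom_eval ?l m) \<le> monom_degree m"
    using mpoly_degree_mult_le[of "mpoly_const (Poly_Mapping.lookup p m)" "monom_eval ?l m"]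
    by (simp add: mpoly_degree_const)
  then show "mpoly_degree (mpoly_const (Poly_Mapping.lookup p m) * monom_eval ?l m) \<le> mpoly_degree p"
    using monom_degree_le[OF m] by linarith
qed

text \<open>
  Among all representations take one of least total degree: a nonconstant common factor could be
  cancelled.
\<close>

lemma exists_coprime_representation:
  fixes f :: "('n::{finite,linorder}, 'k::field) ratfun"
  shows "\<exists>p q. q \<noteq> 0 \<and> f = Fract p q \<and> mpoly_coprime p q"
proof -
  define P where "P = (\<lambda>n. \<exists>p q. q \<noteq> 0 \<and> f = Fract p q \<and> mpoly_degree p + mpoly_degree q = n)"
  have "\<exists>n. P n" unfolding P_def by (cases f) auto
  then obtain n where n: "P n" "\<And>n'. P n' \<Longrightarrow> n \<le> n'"
    by (metis LeastI Least_le)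
  then obtain p q where pq: "q \<noteq> 0" "f = Fract p q" "mpoly_degree p + mpoly_degree q = n"
    unfolding P_def by auto
  have "c dvd 1" if c: "c dvd p" "c dvd q" for c
  proof -
    obtain p' q' where p': "p = c * p'" "q = c * q'" using c by (auto elim!: dvdE)
    then have nz: "c \<noteq> 0" "q' \<noteq> 0" using pq(1) by auto
    have "f = Fract p' q'" using pq(2) p' nz by (simp add: eq_fract mult_ac)
    then have "P (mpoly_degree p' + mpoly_degree q')" using nz unfolding P_def by blast
    then have "mpoly_degree p + mpoly_degree q \<le> mpoly_degree p' + mpoly_degree q'"
      unfolding pq(3) by (rule n(2))
    moreover have "mpoly_degree q = mpoly_degree c + mpoly_degree q'"
      using mpoly_degree_mult nz p' by blast
    moreover have "mpoly_degree p' \<le> mpoly_degree p"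
      using mpoly_degree_mult[of c p'] nz p' by (cases "p' = 0") auto
    ultimately have "mpoly_degree c = 0" by linarith
    then have "c = mpoly_const (Poly_Mapping.lookup c 0)" by (rule mpoly_degree_0_imp_const)
    then obtain x where x: "c = mpoly_const x" by blast
    then have "x \<noteq> 0" using nz by (auto simp: mpoly_const_0)
    then have "c * mpoly_const (inverse x) = 1"
      by (simp add: x mpoly_const_def mult_single)
    then show "c dvd 1" by (metis dvdI)
  qed
  then show ?thesis using pq unfolding mpoly_coprime_def by blast
qed

text \<open>
  The only property of the degree of a rational function on which the bound depends.
\<close>

lemma ratfun_degree_representation:
  obtains p q where "q \<noteq> 0" "f = Fract p q" "ratfun_degree f = mpoly_degree p + mpoly_degree q"
proof -
  have "\<exists>d p q. q \<noteq> 0 \<and> f = Fract p q \<and> mpoly_coprime p q \<and> d = mpoly_degree p + mpoly_degree q"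
    using exists_coprime_representation[of f] by simp
  from someI_ex[OF this] show ?thesis using that unfolding ratfun_degree_def by blast
qed

section \<open>Homomorphisms out of a field of fractions\<close>

text \<open>
  The value is well defined when \<open>h\<close> is an injective ring homomorphism; it is then the extension of \<open>h\<close>
  to the field of fractions.
\<close>

definition fract_hom :: "('r::idom \<Rightarrow> 'f::field) \<Rightarrow> 'r fract \<Rightarrow> 'f" where
  "fract_hom h f = (THE y. \<forall>p q. q \<noteq> 0 \<longrightarrow> f = Fract p q \<longrightarrow> y = h p / h q)"

lemma fract_hom_Fract:
  assumes "comm_ring_hom h" "inj h" "q \<noteq> 0"
  shows "fract_hom h (Fract p q) = h p / h q"
proof -
  interpret h: comm_ring_hom h by fact
  have nz: "h r \<noteq> 0" if "r \<noteq> 0" for r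
    using that injD[OF assms(2), of r 0] by auto
  have eq: "h p / h q = h p' / h q'" if "q' \<noteq> 0" "Fract p q = Fract p' q'" for p' q'
  proof -
    have "p * q' = p' * q" using that assms(3) by (simp add: eq_fract)
    then have "h p * h q' = h p' * h q" by (simp add: h.hom_mult[symmetric])
    then show ?thesis using nz[OF that(1)] nz[OF assms(3)] by (simp add: field_simps)
  qed
  show ?thesis
    unfolding fract_hom_def
    by (rule the_equality) (use eq assms(3) in blast)+
qed

lemma comm_ring_hom_fract_hom:
  assumes "comm_ring_hom h" "inj h"
  shows "comm_ring_hom (fract_hom h)"
proof -
  interpret h: comm_ring_hom h by fact
  have nz: "h r \<noteq> 0" if "r \<noteq> 0" for r
    using that injD[OF assms(2), of r 0] by auto
  note F = fract_hom_Fract[OF assms]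
  show ?thesis
  proof
    show "fract_hom h 0 = 0" using F[of 1 0] by (simp add: Zero_fract_def)
    show "fract_hom h 1 = 1" using F[of 1 1] by (simp add: One_fract_def)
    fix x y :: "'a fract"
    obtain p q where x: "x = Fract p q" "q \<noteq> 0" by (cases x)
    obtain r s where y: "y = Fract r s" "s \<noteq> 0" by (cases y)
    show "fract_hom h (x + y) = fract_hom h x + fract_hom h y"
      using x y nz by (simp add: F h.hom_add h.hom_mult add_frac_eq)
    show "fract_hom h (x * y) = fract_hom h x * fract_hom h y"
      using x y nz by (simp add: F h.hom_mult)
  qed
qed

lemma comm_ring_hom_Fract: "comm_ring_hom (\<lambda>p :: 'r::idom. Fract p 1)"
  by standard (simp_all add: Zero_fract_def One_fract_def)

lemma inj_Fract: "inj (\<lambda>p :: 'r::idom. Fract p 1)"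
  by (rule injI) (simp add: eq_fract)

lemma comm_ring_hom_ratfun_const: "comm_ring_hom (ratfun_const :: 'k::field \<Rightarrow> ('n::{finite,linorder}, 'k) ratfun)"
proof -
  have "(ratfun_const :: 'k \<Rightarrow> ('n, 'k) ratfun) = (\<lambda>x. Fract (mpoly_const x) 1)"
    by (rule ext) (simp add: ratfun_const_def)
  then show ?thesis
    using comm_ring_hom_compose[OF comm_ring_hom_Fract comm_ring_hom_mpoly_const] by metis
qed

text \<open>
  The substitution is the extension of a ring homomorphism to fractions, so it inherits the
  homomorphism laws.
\<close>

lemma ratfun_subst_eq_fract_hom:
  assumes "invertible A"
  shows "ratfun_subst A = fract_hom (\<lambda>p. Fract (mpoly_subst A p) 1)"
proof
  fix f
  interpret A: comm_ring_hom "mpoly_subst A" by (rule comm_ring_hom_mpoly_subst)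
  have nz: "mpoly_subst A q \<noteq> 0" if "q \<noteq> 0" for q
    using that injD[OF inj_mpoly_subst[OF assms], of q 0] by auto
  have *: "(q \<noteq> 0 \<longrightarrow> f = Fract p q \<longrightarrow> y = Fract (mpoly_subst A p) (mpoly_subst A q)) =
        (q \<noteq> 0 \<longrightarrow> f = Fract p q \<longrightarrow> y = Fract (mpoly_subst A p) 1 / Fract (mpoly_subst A q) 1)" for p q y
    by simp
  then show "ratfun_subst A f = fract_hom (\<lambda>p. Fract (mpoly_subst A p) 1) f"
    unfolding ratfun_subst_def fract_hom_def by (simp only: *)
qed

lemma
  assumes "invertible A"
  shows comm_ring_hom_Fract_subst: "comm_ring_hom (\<lambda>p. Fract (mpoly_subst A p) 1)"
    and inj_Fract_subst: "inj (\<lambda>p. Fract (mpoly_subst A p) 1)"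
  using comm_ring_hom_compose[OF comm_ring_hom_Fract comm_ring_hom_mpoly_subst]
    inj_compose[OF inj_Fract inj_mpoly_subst[OF assms]] by (simp_all add: o_def)

lemma comm_ring_hom_ratfun_subst:
  assumes "invertible A"
  shows "comm_ring_hom (ratfun_subst A)"
  unfolding ratfun_subst_eq_fract_hom[OF assms]
  by (rule comm_ring_hom_fract_hom[OF comm_ring_hom_Fract_subst[OF assms] inj_Fract_subst[OF assms]])

lemma ratfun_subst_Fract:
  assumes "invertible A" "q \<noteq> 0"
  shows "ratfun_subst A (Fract p q) = Fract (mpoly_subst A p) (mpoly_subst A q)"
  unfolding ratfun_subst_eq_fract_hom[OF assms(1)]
  by (subst fract_hom_Fract[OF comm_ring_hom_Fract_subst[OF assms(1)] inj_Fract_subst[OF assms(1)] assms(2)]) simp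

lemma mpoly_subst_nonzero:
  assumes "invertible A" "q \<noteq> 0"
  shows "mpoly_subst A q \<noteq> 0"
proof -
  interpret A: comm_ring_hom "mpoly_subst A" by (rule comm_ring_hom_mpoly_subst)
  show ?thesis using assms injD[OF inj_mpoly_subst[OF assms(1)], of q 0] by auto
qed

lemma ratfun_subst_subst:
  assumes "invertible A" "invertible B"
  shows "ratfun_subst A (ratfun_subst B f) = ratfun_subst (B ** A) f"
proof (cases f)
  case (Fract p q)
  then show ?thesis
    using assms by (simp add: ratfun_subst_Fract mpoly_subst_nonzero invertible_mult mpoly_subst_subst)
qed

lemma ratfun_subst_mat_1:
  fixes f :: "('n::{finite,linorder}, 'k::field) ratfun"
  shows "ratfun_subst (Finite_Cartesian_Product.mat 1) f = f"
proof (cases f)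
  case (Fract p q)
  have "invertible (Finite_Cartesian_Product.mat 1 :: 'k ^ 'n::{finite,linorder} ^ 'n::{finite,linorder})"
    unfolding invertible_def by (intro exI[of _ "Finite_Cartesian_Product.mat 1"]) simp
  then show ?thesis using Fract by (simp add: ratfun_subst_Fract mpoly_subst_mat_1)
qed

lemma ratfun_subst_const:
  assumes "invertible A"
  shows "ratfun_subst A (ratfun_const x) = ratfun_const x"
proof -
  interpret A: comm_ring_hom "mpoly_subst A" by (rule comm_ring_hom_mpoly_subst)
  show ?thesis by (simp add: ratfun_const_def ratfun_subst_Fract[OF assms])
qed

section \<open>Algebraic elements and algebraic independence\<close>

lemma type_ring_simps:
  "carrier ring_of_type_algebra = UNIV"
  "(x :: 'f::field) \<otimes>\<^bsub>ring_of_type_algebra\<^esub> y = x * y"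
  "x \<oplus>\<^bsub>ring_of_type_algebra\<^esub> y = x + y"
  "\<zero>\<^bsub>ring_of_type_algebra\<^esub> = (0 :: 'f)"
  "\<one>\<^bsub>ring_of_type_algebra\<^esub> = (1 :: 'f)"
  by (simp_all add: ring_of_type_algebra_def)

lemma type_ring_pow: "(x :: 'f::field) [^]\<^bsub>ring_of_type_algebra\<^esub> (n::nat) = x ^ n"
proof -
  interpret R: field "ring_of_type_algebra :: 'f ring" by (rule field_from_type_algebra)
  show ?thesis by (induction n) (simp_all add: type_ring_simps)
qed

lemma type_ring_uminus: "\<ominus>\<^bsub>ring_of_type_algebra\<^esub> (x :: 'f::field) = - x"
proof -
  interpret R: field "ring_of_type_algebra :: 'f ring" by (rule field_from_type_algebra)
  show ?thesis
    by (rule R.minus_equality) (simp_all add: type_ring_simps)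
qed

lemma type_ring_inverse:
  assumes "(x :: 'f::field) \<noteq> 0"
  shows "inv\<^bsub>ring_of_type_algebra\<^esub> x = inverse x"
proof -
  interpret R: field "ring_of_type_algebra :: 'f ring" by (rule field_from_type_algebra)
  show ?thesis
    by (rule R.comm_inv_char) (simp_all add: type_ring_simps assms)
qed

lemma type_subfieldI:
  fixes L :: "'f::field set"
  assumes "1 \<in> L" "\<And>x y. x \<in> L \<Longrightarrow> y \<in> L \<Longrightarrow> x + y \<in> L" "\<And>x y. x \<in> L \<Longrightarrow> y \<in> L \<Longrightarrow> x * y \<in> L"
    "\<And>x. x \<in> L \<Longrightarrow> - x \<in> L" "\<And>x. x \<in> L \<Longrightarrow> inverse x \<in> L"
  shows "subfield L ring_of_type_algebra"
proof -
  interpret R: field "ring_of_type_algebra :: 'f ring" by (rule field_from_type_algebra)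
  show ?thesis
  proof (rule R.subfieldI')
    show "subring L ring_of_type_algebra"
      by (rule R.subringI) (use assms in \<open>auto simp: type_ring_simps type_ring_uminus\<close>)
    show "inv\<^bsub>ring_of_type_algebra\<^esub> k \<in> L" if "k \<in> L - {\<zero>\<^bsub>ring_of_type_algebra\<^esub>}" for k
      using that assms(5)[of k] by (simp add: type_ring_simps type_ring_inverse)
  qed
qed

lemma type_subfieldD:
  fixes L :: "'f::field set"
  assumes "subfield L ring_of_type_algebra"
  shows "0 \<in> L" "1 \<in> L" "\<And>x y. x \<in> L \<Longrightarrow> y \<in> L \<Longrightarrow> x + y \<in> L" "\<And>x y. x \<in> L \<Longrightarrow> y \<in> L \<Longrightarrow> x * y \<in> L"
    "\<And>x. x \<in> L \<Longrightarrow> - x \<in> L" "\<And>x. x \<in> L \<Longrightarrow> inverse x \<in> L"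
proof -
  interpret R: field "ring_of_type_algebra :: 'f ring" by (rule field_from_type_algebra)
  note s = subringE[OF subfieldE(1)[OF assms], unfolded type_ring_simps type_ring_uminus]
  show "0 \<in> L" by (rule s(2))
  show "1 \<in> L" by (rule s(3))
  show "x \<in> L \<Longrightarrow> y \<in> L \<Longrightarrow> x + y \<in> L" for x y by (rule s(7))
  show "x \<in> L \<Longrightarrow> y \<in> L \<Longrightarrow> x * y \<in> L" for x y by (rule s(6))
  show "x \<in> L \<Longrightarrow> - x \<in> L" for x by (rule s(5))
  show "inverse x \<in> L" if "x \<in> L" for x
    using R.subfield_m_inv(1)[OF assms, of x] that s(2)
    by (cases "x = 0") (auto simp: type_ring_simps type_ring_inverse)
qed

lemma type_subfield_sum:
  fixes L :: "'f::field set"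
  assumes "subfield L ring_of_type_algebra" "\<And>x. x \<in> A \<Longrightarrow> f x \<in> L"
  shows "sum f A \<in> L"
  using assms(2) by (induction A rule: infinite_finite_induct) (auto intro: type_subfieldD[OF assms(1)])

lemma type_subfield_prod:
  fixes L :: "'f::field set"
  assumes "subfield L ring_of_type_algebra" "\<And>x. x \<in> A \<Longrightarrow> f x \<in> L"
  shows "prod f A \<in> L"
  using assms(2) by (induction A rule: infinite_finite_induct) (auto intro: type_subfieldD[OF assms(1)])

lemma type_subfield_power:
  fixes L :: "'f::field set"
  assumes "subfield L ring_of_type_algebra" "x \<in> L"
  shows "x ^ n \<in> L"
  using assms(2) by (induction n) (auto intro: type_subfieldD[OF assms(1)])

lemma type_subfield_mpoly_eval:
  fixes L :: "'f::field set"
  assumes "subfield L ring_of_type_algebra" "\<And>x. c x \<in> L"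
    and "\<And>i. i \<in> \<Union> (Poly_Mapping.keys ` Poly_Mapping.keys P) \<Longrightarrow> a i \<in> L"
  shows "mpoly_eval c a P \<in> L"
  unfolding mpoly_eval_def using assms(2,3)
  by (auto intro!: type_subfield_sum[OF assms(1)] type_subfieldD(4)[OF assms(1)]
      type_subfield_prod[OF assms(1)] type_subfield_power[OF assms(1)])

lemma generate_field_is_type_subfield:
  "subfield (generate_field ring_of_type_algebra (H :: 'f::field set)) ring_of_type_algebra"
proof -
  interpret R: field "ring_of_type_algebra :: 'f ring" by (rule field_from_type_algebra)
  show ?thesis by (rule R.generate_field_is_subfield) (simp add: type_ring_simps)
qed

lemma generate_field_subset:
  assumes "subfield (L :: 'f::field set) ring_of_type_algebra" "H \<subseteq> L"
  shows "generate_field ring_of_type_algebra H \<subseteq> L"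
proof -
  interpret R: field "ring_of_type_algebra :: 'f ring" by (rule field_from_type_algebra)
  show ?thesis by (rule R.generate_field_min_subfield1[OF _ assms]) (simp add: type_ring_simps)
qed

abbreviation algebraic_over :: "'f::field set \<Rightarrow> 'f \<Rightarrow> bool" where
  "algebraic_over L x \<equiv> ring.algebraic ring_of_type_algebra L x"

lemma type_ring_eval: "ring.eval ring_of_type_algebra p (x :: 'f::field) = poly (Poly (rev p)) x"
proof -
  interpret R: field "ring_of_type_algebra :: 'f ring" by (rule field_from_type_algebra)
  show ?thesis
    by (induction p) (simp_all add: type_ring_simps type_ring_pow Poly_snoc poly_monom)
qed

text \<open>
  A translation between the polynomials over a subfield given by their coefficient lists, leading
  coefficient first, and univariate polynomials over the whole field with coefficients in the
  subfield.
\<close>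

lemma algebraic_over_iff:
  fixes L :: "'f::field set"
  assumes L: "subfield L ring_of_type_algebra"
  shows "algebraic_over L x \<longleftrightarrow>
    (\<exists>p :: 'f Polynomial.poly. p \<noteq> 0 \<and> (\<forall>i. Polynomial.coeff p i \<in> L) \<and> poly p x = 0)"
proof -
  interpret R: field "ring_of_type_algebra :: 'f ring" by (rule field_from_type_algebra)
  note carr = univ_poly_carrier[of ring_of_type_algebra L, symmetric]
  show ?thesis
  proof
    assume "algebraic_over L x"
    then obtain p where p: "p \<in> carrier (L [X]\<^bsub>ring_of_type_algebra\<^esub>)" "p \<noteq> []"
        "R.eval p x = \<zero>\<^bsub>ring_of_type_algebra\<^esub>"
      using R.algebraicE[OF subfieldE(1)[OF L], of x] by (auto simp: over_def type_ring_simps)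
    then have pL: "set p \<subseteq> L" "hd p \<noteq> 0"
      using univ_poly_carrier[of ring_of_type_algebra L p] by (auto simp: polynomial_def type_ring_simps)
    have "Poly (rev p) \<noteq> 0"
    proof
      assume "Poly (rev p) = 0"
      then obtain n where "rev p = replicate n 0" using Poly_eq_0 by blast
      then have "set p \<subseteq> {0}" by (metis set_rev set_replicate_conv_if empty_subsetI order_refl)
      then show False using pL(2) p(2) hd_in_set by blast
    qed
    moreover have "Polynomial.coeff (Poly (rev p)) i \<in> L" for i
      using pL(1) type_subfieldD(1)[OF L] by (auto simp: coeff_Poly_eq nth_default_def) (metis in_mono length_rev nth_mem set_rev)
    moreover have "poly (Poly (rev p)) x = 0" using p(3) by (simp add: type_ring_eval type_ring_simps)
    ultimately show "\<exists>p :: 'f Polynomial.poly. p \<noteq> 0 \<and> (\<forall>i. Polynomial.coeff p i \<in> L) \<and> poly p x = 0" by blast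
  next
    assume "\<exists>p :: 'f Polynomial.poly. p \<noteq> 0 \<and> (\<forall>i. Polynomial.coeff p i \<in> L) \<and> poly p x = 0"
    then obtain p :: "'f Polynomial.poly" where p: "p \<noteq> 0" "\<And>i. Polynomial.coeff p i \<in> L" "poly p x = 0" by blast
    let ?q = "rev (coeffs p)"
    have "hd ?q \<noteq> 0" "?q \<noteq> []" using p(1) by (simp_all add: hd_rev last_coeffs_eq_coeff_degree)
    moreover have "set ?q \<subseteq> L" using p(2) by (auto simp: coeffs_def)
    ultimately have "?q \<in> carrier (L [X]\<^bsub>ring_of_type_algebra\<^esub>)"
      using univ_poly_carrier[of ring_of_type_algebra L ?q] by (auto simp: polynomial_def type_ring_simps)
    then have "(R.algebraic over L) x"
      by (rule R.algebraicI) (use p in \<open>simp_all add: type_ring_eval type_ring_simps\<close>)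
    then show "algebraic_over L x" by (simp add: over_def)
  qed
qed

lemma algebraic_over_self:
  assumes "subfield L ring_of_type_algebra" "x \<in> L"
  shows "algebraic_over L x"
  unfolding algebraic_over_iff[OF assms(1)]
  using assms(2) type_subfieldD[OF assms(1)]
  by (intro exI[of _ "[:- x, 1:]"]) (auto simp: coeff_pCons split: nat.split)

lemma algebraic_over_subfield:
  fixes L :: "'f::field set"
  assumes "subfield L ring_of_type_algebra"
  shows "subfield {x. algebraic_over L x} ring_of_type_algebra"
proof -
  interpret R: field "ring_of_type_algebra :: 'f ring" by (rule field_from_type_algebra)
  show ?thesis using R.subfield_of_algebraics[OF assms] by (simp add: type_ring_simps over_def)
qed

text \<open>
  Adjoining the finitely many coefficients gives a finite extension \<open>E\<close> of \<open>L\<close>, and adjoining \<open>x\<close> to \<open>E\<close>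
  another one; by multiplicativity of degrees \<open>x\<close> lies in a finite extension of \<open>L\<close>.
\<close>

lemma algebraic_over_trans:
  fixes L :: "'f::field set"
  assumes L: "subfield L ring_of_type_algebra" and p: "p \<noteq> 0" "poly p x = 0"
    and alg: "\<And>i. algebraic_over L (Polynomial.coeff p i)"
  shows "algebraic_over L x"
proof -
  interpret R: field "ring_of_type_algebra :: 'f ring" by (rule field_from_type_algebra)
  have UN: "set xs \<subseteq> carrier ring_of_type_algebra" for xs :: "'f list" by (simp add: type_ring_simps)
  have alg': "(R.algebraic over L) y" if "y \<in> set (coeffs p)" for y
    using that alg by (auto simp: coeffs_def over_def split: if_splits)
  let ?E = "R.finite_extension L (coeffs p)"
  have E: "subfield ?E ring_of_type_algebra"
    by (rule R.finite_extension_is_subfield[OF L UN alg'])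
  have mem: "set (coeffs p) \<subseteq> ?E"
    by (rule R.finite_extension_mem[OF subfieldE(1)[OF L] UN])
  have "Polynomial.coeff p i \<in> ?E" for i
  proof (cases "i \<le> Polynomial.degree p")
    case True
    then have "Polynomial.coeff p i \<in> set (coeffs p)" using p(1) by (simp add: coeff_in_coeffs)
    then show ?thesis using mem by blast
  next
    case False
    then show ?thesis using type_subfieldD(1)[OF E] by (simp add: coeff_eq_0)
  qed
  then have "algebraic_over ?E x" unfolding algebraic_over_iff[OF E] using p by blast
  then have "R.finite_dimension ?E (R.simple_extension ?E x)"
    using R.finite_dimension_simple_extension[OF E, of x] by (simp add: type_ring_simps over_def)
  then have "R.finite_dimension L (R.finite_extension L (x # coeffs p))"
    using R.telescopic_base_dim(1)[OF L E R.finite_extension_finite_dimension(1)[OF L UN alg']] by simp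
  then have "(R.algebraic over L) x"
    by (rule R.finite_extension_finite_dimension(2)[OF L UN]) simp
  then show ?thesis by (simp add: over_def)
qed

text \<open>
  A relation \<open>P\<close> on \<open>S\<close> and \<open>a\<close>, sorted by powers of \<open>a\<close>, is a univariate polynomial that annihilates \<open>a\<close>. Its
  coefficients are polynomials in \<open>S\<close>, and not all of them vanish because \<open>S\<close> is independent.
\<close>

lemma algebraic_over_of_dependent:
  fixes c :: "'k::field \<Rightarrow> 'f::field"
  assumes c: "comm_ring_hom c" and ind: "algebraically_independent c S"
    and dep: "\<not> algebraically_independent c (insert a S)"
  shows "algebraic_over (generate_field ring_of_type_algebra (range c \<union> S)) a"
proof -
  let ?L = "generate_field ring_of_type_algebra (range c \<union> S)"
  interpret c: comm_ring_hom c by fact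
  have L: "subfield ?L ring_of_type_algebra" by (rule generate_field_is_type_subfield)
  have incl: "range c \<union> S \<subseteq> ?L" by (auto intro: generate_field.incl)
  obtain P :: "('f, 'k) mpoly" where P: "\<forall>m\<in>Poly_Mapping.keys P. Poly_Mapping.keys m \<subseteq> insert a S"
      "mpoly_eval c (\<lambda>s. s) P = 0" "P \<noteq> 0"
    using dep unfolding algebraically_independent_def by blast
  define K where "K e = {m \<in> Poly_Mapping.keys P. Poly_Mapping.lookup m a = e}" for e
  \<comment> \<open>The exponent of \<open>a\<close> is removed from a monomial; \<open>Q e\<close> is the coefficient of \<open>a\<^sup>e\<close> in \<open>P\<close>,
      and \<open>u e\<close> its value.\<close>
  define rest where "rest m = Poly_Mapping.update a 0 m" for m :: "'f \<Rightarrow>\<^sub>0 nat"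
  define Q where "Q e = (\<Sum>m\<in>K e. Poly_Mapping.single (rest m) (Poly_Mapping.lookup P m))" for e
  define u where "u e = (\<Sum>m\<in>K e. c (Poly_Mapping.lookup P m) * monom_eval (\<lambda>s. s) (rest m))" for e
  have finK: "finite (K e)" for e by (simp add: K_def)
  interpret ev: comm_ring_hom "mpoly_eval c (\<lambda>s. s) :: ('f, 'k) mpoly \<Rightarrow> 'f"
    by (rule comm_ring_hom_mpoly_eval[OF c])
  have u: "u e = mpoly_eval c (\<lambda>s. s) (Q e)" for e
    by (simp add: u_def Q_def ev.hom_sum mpoly_eval_single)
  have keys_rest: "Poly_Mapping.keys (rest m) \<subseteq> S" if "m \<in> K e" for m e
    using that P(1) by (auto simp: K_def rest_def keys_update)
  have keysQ: "\<forall>m\<in>Poly_Mapping.keys (Q e). Poly_Mapping.keys m \<subseteq> S" for e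
  proof
    fix m assume "m \<in> Poly_Mapping.keys (Q e)"
    then have "(\<Sum>m'\<in>K e. Poly_Mapping.lookup (Poly_Mapping.single (rest m') (Poly_Mapping.lookup P m')) m) \<noteq> 0"
      by (simp add: in_keys_iff Q_def lookup_sum)
    then obtain m' where "m' \<in> K e" "rest m' = m"
      by (metis (no_types, lifting) lookup_single_not_eq sum.neutral)
    then show "Poly_Mapping.keys m \<subseteq> S" using keys_rest by blast
  qed
  have uL: "u e \<in> ?L" for e
    unfolding u
  proof (rule type_subfield_mpoly_eval[OF L])
    fix i assume "i \<in> \<Union> (Poly_Mapping.keys ` Poly_Mapping.keys (Q e))"
    then show "i \<in> ?L" using incl keysQ[of e] by blast
  qed (use incl in blast)
  define p where "p = (\<Sum>e\<in>(\<lambda>m. Poly_Mapping.lookup m a) ` Poly_Mapping.keys P. Polynomial.monom (u e) e)"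
  have coeff_p: "Polynomial.coeff p e = u e" for e
  proof -
    have "K e = {}" if "e \<notin> (\<lambda>m. Poly_Mapping.lookup m a) ` Poly_Mapping.keys P"
      using that by (auto simp: K_def)
    then show ?thesis by (auto simp: p_def coeff_sum coeff_monom u_def)
  qed
  have split: "monom_eval (\<lambda>s. s) m = a ^ Poly_Mapping.lookup m a * monom_eval (\<lambda>s. s) (rest m)" for m
  proof -
    let ?A = "insert a (Poly_Mapping.keys m)"
    have "monom_eval (\<lambda>s. s) m = (\<Prod>s\<in>?A. s ^ Poly_Mapping.lookup m s)"
      by (rule monom_eval_superset) auto
    also have "\<dots> = a ^ Poly_Mapping.lookup m a * (\<Prod>s\<in>?A - {a}. s ^ Poly_Mapping.lookup m s)"
      by (rule prod.remove) auto
    also have "(\<Prod>s\<in>?A - {a}. s ^ Poly_Mapping.lookup m s) = monom_eval (\<lambda>s. s) (rest m)"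
      by (rule prod.cong) (auto simp: rest_def keys_update lookup_update)
    finally show ?thesis .
  qed
  have "poly p a = (\<Sum>e\<in>(\<lambda>m. Poly_Mapping.lookup m a) ` Poly_Mapping.keys P. \<Sum>m\<in>K e.
      c (Poly_Mapping.lookup P m) * monom_eval (\<lambda>s. s) m)"
    unfolding p_def poly_sum poly_monom u_def sum_distrib_right
  proof (intro sum.cong refl)
    fix e m assume "m \<in> K e"
    then show "c (Poly_Mapping.lookup P m) * monom_eval (\<lambda>s. s) (rest m) * a ^ e
        = c (Poly_Mapping.lookup P m) * monom_eval (\<lambda>s. s) m"
      unfolding split[of m] by (simp add: K_def mult_ac)
  qed
  also have "\<dots> = mpoly_eval c (\<lambda>s. s) P"
    unfolding mpoly_eval_def K_def by (rule sum.group) auto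
  finally have "poly p a = 0" using P(2) by simp
  moreover have "p \<noteq> 0"
  proof
    assume "p = 0"
    then have "mpoly_eval c (\<lambda>s. s) (Q e) = 0" for e using coeff_p[of e] u by simp
    then have Q0: "Q e = 0" for e
      using ind keysQ unfolding algebraically_independent_def by blast
    obtain m where m: "m \<in> Poly_Mapping.keys P" using P(3) by (metis equals0I keys_eq_empty)
    let ?e = "Poly_Mapping.lookup m a"
    have inj: "m' = m" if "m' \<in> K ?e" "rest m' = rest m" for m'
    proof (rule poly_mapping_eqI)
      fix k
      have "Poly_Mapping.lookup (rest m') k = Poly_Mapping.lookup (rest m) k" using that(2) by simp
      then show "Poly_Mapping.lookup m' k = Poly_Mapping.lookup m k"
        using that(1) by (cases "k = a") (simp_all add: K_def rest_def[of m'] rest_def[of m] lookup_update)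
    qed
    have "Poly_Mapping.lookup (Q ?e) (rest m)
        = (\<Sum>m'\<in>K ?e. if m' = m then Poly_Mapping.lookup P m else 0)"
      unfolding Q_def lookup_sum
      by (intro sum.cong refl) (auto simp: lookup_single when_def dest: inj)
    also have "\<dots> = Poly_Mapping.lookup P m"
      using finK m by (subst sum.delta) (auto simp: K_def)
    finally show False using Q0[of ?e] m by (simp add: in_keys_iff)
  qed
  ultimately show ?thesis
    unfolding algebraic_over_iff[OF L] using uL coeff_p by metis
qed

section \<open>Orbit polynomials and invariants\<close>

lemma map_poly_hom_mult:
  assumes "comm_ring_hom h"
  shows "map_poly h (p * q) = map_poly h p * map_poly h q"
proof -
  interpret h: comm_ring_hom h by fact
  show ?thesis
    by (rule poly_eqI) (simp add: coeff_map_poly coeff_mult h.hom_sum h.hom_mult)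
qed

lemma map_poly_hom_prod:
  assumes "comm_ring_hom h"
  shows "map_poly h (\<Prod>x\<in>A. f x) = (\<Prod>x\<in>A. map_poly h (f x))"
proof -
  interpret h: comm_ring_hom h by fact
  show ?thesis
    by (induction A rule: infinite_finite_induct) (simp_all add: map_poly_hom_mult[OF assms])
qed

lemma poly_map_poly_hom:
  assumes "comm_ring_hom h"
  shows "poly (map_poly h p) (h x) = h (poly p x)"
proof -
  interpret h: comm_ring_hom h by fact
  show ?thesis
    by (induction p) (simp_all add: map_poly_pCons h.hom_add h.hom_mult)
qed

lemma ratfun_mem_subfield:
  fixes L :: "('n::{finite,linorder}, 'k::field) ratfun set"
  assumes L: "subfield L ring_of_type_algebra" and c: "range ratfun_const \<subseteq> L"
    and v: "\<And>i. Fract (mpoly_var i) 1 \<in> L"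
  shows "f \<in> L"
proof -
  have mem: "Fract p 1 \<in> L" for p :: "('n, 'k) mpoly"
    unfolding mpoly_hom_eq_eval[OF comm_ring_hom_Fract, of p]
    by (rule type_subfield_mpoly_eval[OF L]) (use c v in \<open>auto simp: ratfun_const_def\<close>)
  obtain p q where f: "f = Fract p q" "q \<noteq> 0" by (cases f)
  then have "f = Fract p 1 * inverse (Fract q 1)" by simp
  then show ?thesis using type_subfieldD(4,6)[OF L] mem by metis
qed

locale finite_matrix_rep = group G for G :: "('g, 'x) monoid_scheme" (structure) +
  fixes \<rho> :: "'g \<Rightarrow> 'k::field ^ 'n::{finite,linorder} ^ 'n::{finite,linorder}"
  assumes finite_carrier: "finite (carrier G)" and rep_hom: "\<rho> \<in> hom G GL"
begin

lemma rep_invertible: "g \<in> carrier G \<Longrightarrow> invertible (\<rho> g)"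
  using rep_hom by (auto simp: hom_def GL_def)

lemma rep_mult: "g \<in> carrier G \<Longrightarrow> h \<in> carrier G \<Longrightarrow> \<rho> (g \<otimes> h) = \<rho> g ** \<rho> h"
  using rep_hom by (auto simp: hom_def GL_def)

lemma rep_one: "\<rho> \<one> = Finite_Cartesian_Product.mat 1"
proof -
  obtain B where B: "B ** \<rho> \<one> = Finite_Cartesian_Product.mat 1"
    using rep_invertible[OF one_closed] unfolding invertible_def by blast
  have "\<rho> \<one> ** \<rho> \<one> = \<rho> \<one>" using rep_mult[of \<one> \<one>] by simp
  then have "B ** (\<rho> \<one> ** \<rho> \<one>) = Finite_Cartesian_Product.mat 1" using B by simp
  then show ?thesis by (simp add: matrix_mul_assoc B)
qed

definition act :: "'g \<Rightarrow> ('n, 'k) ratfun \<Rightarrow> ('n, 'k) ratfun" where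
  "act g = ratfun_subst (\<rho> (inv g))"

lemma invariant_field_act: "invariant_field G \<rho> = {f. \<forall>g\<in>carrier G. act g f = f}"
  by (simp add: invariant_field_def act_def)

lemma comm_ring_hom_act: "g \<in> carrier G \<Longrightarrow> comm_ring_hom (act g)"
  unfolding act_def by (intro comm_ring_hom_ratfun_subst rep_invertible) simp

lemma act_act: "g \<in> carrier G \<Longrightarrow> h \<in> carrier G \<Longrightarrow> act g (act h f) = act (g \<otimes> h) f"
  unfolding act_def
  by (subst ratfun_subst_subst) (simp_all add: rep_invertible inv_mult_group rep_mult)

text \<open>
  The monic polynomial whose roots are the conjugates of \<open>f\<close>; its coefficients are invariant, hence
  every rational function is algebraic over the field of invariants.
\<close>

definition orbit_poly :: "('n, 'k) ratfun \<Rightarrow> ('n, 'k) ratfun Polynomial.poly" where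
  "orbit_poly f = (\<Prod>g\<in>carrier G. [:- act g f, 1:])"

lemma orbit_poly_nonzero: "orbit_poly f \<noteq> 0"
  using finite_carrier by (simp add: orbit_poly_def)

lemma poly_orbit_poly: "poly (orbit_poly f) f = 0"
proof -
  have "act \<one> f = f" by (simp add: act_def rep_one ratfun_subst_mat_1)
  then have "\<exists>g\<in>carrier G. poly [:- act g f, 1:] f = 0" by (intro bexI[of _ \<one>]) simp_all
  then show ?thesis unfolding orbit_poly_def poly_prod
    using finite_carrier by (simp only: prod_zero_iff)
qed

lemma coeff_orbit_poly_invariant: "Polynomial.coeff (orbit_poly f) i \<in> invariant_field G \<rho>"
  unfolding invariant_field_act
proof (intro CollectI ballI)
  fix h assume h: "h \<in> carrier G"
  interpret a: comm_ring_hom "act h" by (rule comm_ring_hom_act[OF h])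
  have "map_poly (act h) (orbit_poly f) = (\<Prod>g\<in>carrier G. map_poly (act h) [:- act g f, 1:])"
    unfolding orbit_poly_def by (rule map_poly_hom_prod[OF comm_ring_hom_act[OF h]])
  also have "\<dots> = (\<Prod>g\<in>carrier G. [:- act (h \<otimes> g) f, 1:])"
    by (intro prod.cong refl) (simp add: map_poly_pCons a.hom_uminus act_act h)
  also have "\<dots> = orbit_poly f"
    unfolding orbit_poly_def
    by (rule prod.reindex_bij_witness[where i = "\<lambda>g. inv h \<otimes> g" and j = "\<lambda>g. h \<otimes> g"])
      (use h in \<open>simp_all flip: m_assoc\<close>)
  finally show "act h (Polynomial.coeff (orbit_poly f) i) = Polynomial.coeff (orbit_poly f) i"
    by (metis coeff_map_poly a.hom_zero)
qed

lemma algebraic_over_if_orbit_coeffs_algebraic: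
  assumes "subfield L ring_of_type_algebra"
    and "\<And>i. algebraic_over L (Polynomial.coeff (orbit_poly f) i)"
  shows "algebraic_over L f"
  by (rule algebraic_over_trans[OF assms(1) orbit_poly_nonzero poly_orbit_poly assms(2)])

lemma algebraic_over_transcendence_basis:
  assumes "transcendence_basis ratfun_const (invariant_field G \<rho>) S"
  shows "algebraic_over (generate_field ring_of_type_algebra (range ratfun_const \<union> S)) f"
  by (rule algebraic_over_if_orbit_coeffs_algebraic[OF generate_field_is_type_subfield])
    (use assms coeff_orbit_poly_invariant in \<open>auto simp: transcendence_basis_def\<close>)

text \<open>
  The minimum that defines \<open>gamma_field_r\<close> is attained. The coefficients of the orbit polynomials of the
  variables form a finite set \<open>A\<close> of invariants, and the variables are algebraic over the field
  that \<open>A\<close> generates. So a maximal independent subset of \<open>A\<close> is a transcendence basis, and its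
  degrees are bounded because \<open>A\<close> is finite.
\<close>

lemma exists_bounded_transcendence_basis:
  "\<exists>d>0. \<exists>S \<subseteq> {f \<in> invariant_field G \<rho>. ratfun_degree f \<le> d}.
     transcendence_basis ratfun_const (invariant_field G \<rho>) S"
proof -
  let ?c = "ratfun_const :: 'k \<Rightarrow> ('n, 'k) ratfun"
  let ?x = "\<lambda>i. Fract (mpoly_var i) 1 :: ('n, 'k) ratfun"
  define A where "A = (\<Union>i. Polynomial.coeff (orbit_poly (?x i)) ` {..Polynomial.degree (orbit_poly (?x i))})"
  have finA: "finite A" and AK: "A \<subseteq> invariant_field G \<rho>"
    using coeff_orbit_poly_invariant by (auto simp: A_def)
  interpret c: comm_ring_hom ?c by (rule comm_ring_hom_ratfun_const)
  have c0: "x = 0" if "?c x = 0" for x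
  proof -
    have "mpoly_const x = (0 :: ('n, 'k) mpoly)"
      using that by (simp add: ratfun_const_def Zero_fract_def eq_fract)
    then have "Poly_Mapping.lookup (mpoly_const x :: ('n, 'k) mpoly) 0 = 0" by simp
    then show ?thesis by (simp add: mpoly_const_def)
  qed
  have "algebraically_independent ?c {}"
    unfolding algebraically_independent_def
  proof (intro allI impI)
    fix P :: "(('n, 'k) ratfun, 'k) mpoly"
    assume P: "\<forall>m\<in>Poly_Mapping.keys P. Poly_Mapping.keys m \<subseteq> {}" "mpoly_eval ?c (\<lambda>s. s) P = 0"
    then have keys: "Poly_Mapping.keys P \<subseteq> {0}" by auto
    have "mpoly_eval ?c (\<lambda>s. s) P = (\<Sum>m\<in>{0}. ?c (Poly_Mapping.lookup P m) * monom_eval (\<lambda>s. s) m)"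
      using c.hom_zero keys by (intro mpoly_eval_superset) simp_all
    then have "Poly_Mapping.lookup P 0 = 0" using P(2) c0 by simp
    then have "Poly_Mapping.lookup P m = 0" for m
      using keys by (cases "m = 0") (auto simp: in_keys_iff)
    then show "P = 0" by (intro poly_mapping_eqI) simp
  qed
  then have ne: "{S. S \<subseteq> A \<and> algebraically_independent ?c S} \<noteq> {}" by blast
  have fin: "finite {S. S \<subseteq> A \<and> algebraically_independent ?c S}"
    by (rule finite_subset[of _ "Pow A"]) (use finA in auto)
  obtain S where S: "S \<subseteq> A" "algebraically_independent ?c S"
    and max: "\<And>S'. S' \<subseteq> A \<Longrightarrow> algebraically_independent ?c S' \<Longrightarrow> S \<subseteq> S' \<Longrightarrow> S = S'"
    using finite_has_maximal[OF fin ne] by auto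
  let ?L = "generate_field ring_of_type_algebra (range ?c \<union> S)"
  have L: "subfield ?L ring_of_type_algebra" by (rule generate_field_is_type_subfield)
  note Alg = algebraic_over_subfield[OF L]
  have A_alg: "algebraic_over ?L a" if a: "a \<in> A" for a
  proof (cases "a \<in> S")
    case True
    then have "a \<in> ?L" by (intro generate_field.incl) blast
    then show ?thesis by (rule algebraic_over_self[OF L])
  next
    case False
    then have "\<not> algebraically_independent ?c (insert a S)"
      using max[of "insert a S"] a S(1) by blast
    then show ?thesis by (rule algebraic_over_of_dependent[OF comm_ring_hom_ratfun_const S(2)])
  qed
  have x_alg: "algebraic_over ?L (?x i)" for i
  proof (rule algebraic_over_if_orbit_coeffs_algebraic[OF L])
    fix k
    show "algebraic_over ?L (Polynomial.coeff (orbit_poly (?x i)) k)"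
    proof (cases "k \<le> Polynomial.degree (orbit_poly (?x i))")
      case True
      then show ?thesis by (intro A_alg) (auto simp: A_def)
    next
      case False
      then show ?thesis using type_subfieldD(1)[OF Alg] by (simp add: coeff_eq_0)
    qed
  qed
  have "f \<in> {x. algebraic_over ?L x}" for f
  proof (rule ratfun_mem_subfield[OF Alg])
    show "range ?c \<subseteq> {x. algebraic_over ?L x}"
    proof
      fix y assume "y \<in> range ?c"
      then have "y \<in> ?L" by (intro generate_field.incl) blast
      then show "y \<in> {x. algebraic_over ?L x}" using algebraic_over_self[OF L] by blast
    qed
    show "?x i \<in> {x. algebraic_over ?L x}" for i using x_alg by blast
  qed
  then have "transcendence_basis ?c (invariant_field G \<rho>) S"
    using S AK by (auto simp: transcendence_basis_def)
  moreover define d where "d = Suc (Max (ratfun_degree ` A))"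
  have "ratfun_degree a \<le> d" if "a \<in> S" for a
  proof -
    have "ratfun_degree a \<le> Max (ratfun_degree ` A)"
      using finA S(1) that by (intro Max_ge) auto
    then show ?thesis by (simp add: d_def)
  qed
  then have "S \<subseteq> {f \<in> invariant_field G \<rho>. ratfun_degree f \<le> d}" using S(1) AK by auto
  moreover have "d > 0" by (simp add: d_def)
  ultimately show ?thesis by blast
qed

end

section \<open>Simultaneous diagonalisation\<close>

text \<open>
  Some \<open>N\<close>-th root of unity \<open>w\<close> has \<open>w\<^sup>i \<noteq> 1\<close>, since there are \<open>N\<close> of them and at most \<open>i\<close> can be \<open>i\<close>-th roots
  of unity; multiplication by \<open>w\<close> permutes them and multiplies the sum by \<open>w\<^sup>i\<close>.
\<close>

lemma roots_of_unity_sum_zero: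
  fixes Z :: "'a::field set"
  assumes Z: "Z = {z. z ^ N = 1}" and N: "N > 0" and card: "card Z = N" and i: "0 < i" "i < N"
  shows "(\<Sum>z\<in>Z. z ^ i) = 0"
proof -
  have fin: "finite Z" using card N card_ge_0_finite by blast
  define p where "p = Polynomial.monom (1::'a) i - 1"
  have deg: "Polynomial.degree p = i"
    unfolding p_def diff_conv_add_uminus
    by (subst Polynomial.degree_add_eq_left) (use i in \<open>auto simp: degree_monom_eq\<close>)
  then have "p \<noteq> 0" using i by auto
  have "\<not> Z \<subseteq> {z. poly p z = 0}"
    using card_mono[OF poly_roots_finite[OF \<open>p \<noteq> 0\<close>], of Z] card_poly_roots_bound[OF \<open>p \<noteq> 0\<close>]
      deg card i by linarith
  then obtain w where w: "w \<in> Z" "w ^ i \<noteq> 1" by (auto simp: p_def poly_monom)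
  have w0: "w \<noteq> 0" using w(1) N Z by (auto simp: power_0_left)
  have "bij_betw (\<lambda>z. w * z) Z Z"
    by (rule bij_betwI[where g = "\<lambda>z. inverse w * z"])
      (use w(1) w0 in \<open>auto simp: Z power_mult_distrib power_inverse\<close>)
  then have "(\<Sum>z\<in>Z. z ^ i) = (\<Sum>z\<in>Z. (w * z) ^ i)"
    by (rule sum.reindex_bij_betw[symmetric])
  also have "\<dots> = w ^ i * (\<Sum>z\<in>Z. z ^ i)" by (simp add: power_mult_distrib sum_distrib_left)
  finally show ?thesis using w(2) by (metis mult_cancel_right mult_1)
qed

text \<open>
  A double root of \<open>X\<^sup>N - 1\<close> would be a root of the derivative \<open>N X\<^sup>N\<^sup>-\<^sup>1\<close>.
\<close>

lemma card_roots_of_unity: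
  assumes "N > 0" "of_nat N \<noteq> (0 :: 'a::alg_closed_field)"
  shows "card {z :: 'a. z ^ N = 1} = N"
proof -
  define p where "p = Polynomial.monom (1::'a) N - 1"
  have deg: "Polynomial.degree p = N"
    unfolding p_def diff_conv_add_uminus
    by (subst Polynomial.degree_add_eq_left) (use assms in \<open>auto simp: degree_monom_eq\<close>)
  then have p0: "p \<noteq> 0" using assms by auto
  obtain A where A: "size A = Polynomial.degree p" "p = Polynomial.smult (Polynomial.lead_coeff p) (\<Prod>x\<in>#A. [:- x, 1:])"
    using alg_closed_imp_factorization[OF p0] by blast
  have roots: "set_mset A = {z. z ^ N = 1}"
  proof -
    have "poly p z = Polynomial.lead_coeff p * (\<Prod>x\<in>#A. z - x)" for z
      by (subst A(2)) (simp add: poly_prod_mset image_mset.compositionality o_def)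
    then have "poly p z = 0 \<longleftrightarrow> z \<in># A" for z
      using p0 by (auto simp: prod_mset_zero_iff)
    then show ?thesis by (auto simp: p_def poly_monom)
  qed
  have "count A z \<le> 1" for z
  proof (rule ccontr)
    assume "\<not> count A z \<le> 1"
    then have "2 \<le> count A z" by simp
    then have "replicate_mset 2 z \<subseteq># A" by (rule iffD1[OF count_le_replicate_mset_subset_eq])
    then obtain B where B: "A = replicate_mset 2 z + B" by (metis subset_mset.le_iff_add)
    define q where "q = Polynomial.smult (Polynomial.lead_coeff p) (\<Prod>x\<in>#B. [:- x, 1:])"
    define d where "d = [:- z, 1:]"
    have "p = d * (d * q)"
      by (subst A(2)) (simp add: B q_def numeral_2_eq_2 flip: d_def)
    moreover have "poly d z = 0" by (simp add: d_def)
    ultimately have "poly (pderiv p) z = 0" by (simp add: pderiv_mult)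
    moreover have "poly (pderiv p) z = of_nat N * z ^ (N - 1)"
      by (simp add: p_def pderiv_diff pderiv_monom poly_monom)
    moreover have "z ^ N = 1"
      using B roots by auto
    then have "z \<noteq> 0" using assms(1) by (auto simp: power_0_left)
    ultimately show False using assms(2) by simp
  qed
  have "A = mset_set (set_mset A)"
  proof (rule multiset_eqI)
    fix z
    show "count A z = count (mset_set (set_mset A)) z"
      using \<open>count A z \<le> 1\<close> by (cases "z \<in># A") (auto simp: count_mset_set le_Suc_eq count_eq_zero_iff)
  qed
  then have "size A = card (set_mset A)" by (metis size_mset_set)
  then show ?thesis using A(1) deg roots by simp
qed

definition mat_pow :: "'a::field ^ 'n ^ 'n \<Rightarrow> nat \<Rightarrow> 'a ^ 'n \<Rightarrow> 'a ^ 'n" where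
  "mat_pow A i v = ((\<lambda>u. A *v u) ^^ i) v"

text \<open>
  The sum over \<open>i < N\<close> of \<open>z\<^sup>i A\<^sup>i u\<close> is zero or an eigenvector for each \<open>N\<close>-th root of unity \<open>z\<close>, and these
  vectors add up to \<open>N u\<close>. In the application \<open>U\<close> is a
  joint eigenspace of the matrices treated before, so that the new eigenvectors are joint ones.
\<close>

lemma span_eigenvectors_step:
  fixes A :: "'a::alg_closed_field ^ 'n ^ 'n" and U :: "('a ^ 'n) set"
  assumes N: "N > 0" "of_nat N \<noteq> (0 :: 'a)"
    and ord: "\<And>v. mat_pow A N v = v"
    and U: "\<And>u c. u \<in> U \<Longrightarrow> A *v u \<in> U" "vec.subspace U"
    and u: "u \<in> U"
  shows "u \<in> vec.span {v \<in> U. \<exists>z. A *v v = z *s v}"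
proof -
  define Z where "Z = {z :: 'a. z ^ N = 1}"
  have cZ: "card Z = N" unfolding Z_def by (rule card_roots_of_unity[OF N])
  then have finZ: "finite Z" using N card_ge_0_finite by blast
  define pr where "pr z = (\<Sum>i<N. z ^ i *s mat_pow A i u)" for z
  have powU: "mat_pow A i u \<in> U" for i
    by (induction i) (auto simp: mat_pow_def u U(1))
  have prU: "pr z \<in> U" for z
    unfolding pr_def using powU by (intro vec.subspace_sum vec.subspace_scale U(2)) auto
  have eig: "A *v pr z = inverse z *s pr z" if z: "z \<in> Z" for z
  proof -
    have z0: "z \<noteq> 0" using z N(1) by (auto simp: Z_def power_0_left)
    have "z *s (A *v pr z) = (\<Sum>i<N. z ^ Suc i *s mat_pow A (Suc i) u)"
      by (simp add: pr_def vec.linear_sum[OF matrix_vector_mul_linear_gen] vec.scale_sum_right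
          vec.scale mat_pow_def vector_smult_assoc)
    also have "\<dots> = (\<Sum>i<N. z ^ i *s mat_pow A i u)"
    proof -
      have "(\<Sum>i<Suc N. z ^ i *s mat_pow A i u) = (\<Sum>i<N. z ^ Suc i *s mat_pow A (Suc i) u) + u"
        by (subst sum.lessThan_Suc_shift) (simp add: mat_pow_def)
      moreover have "(\<Sum>i<Suc N. z ^ i *s mat_pow A i u) = (\<Sum>i<N. z ^ i *s mat_pow A i u) + u"
        using z ord by (simp add: Z_def)
      ultimately show ?thesis by simp
    qed
    finally have "z *s (A *v pr z) = pr z" by (simp add: pr_def)
    then show ?thesis using z0 by (metis vector_smult_assoc left_inverse vector_smult_lid)
  qed
  have "(\<Sum>z\<in>Z. pr z) = (\<Sum>i<N. (\<Sum>z\<in>Z. z ^ i) *s mat_pow A i u)"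
    unfolding pr_def by (subst sum.swap) (simp add: vec.scale_sum_left)
  also have "\<dots> = (\<Sum>i<N. if i = 0 then of_nat N *s u else 0)"
    using roots_of_unity_sum_zero[OF Z_def N(1) cZ] cZ by (intro sum.cong) (auto simp: mat_pow_def)
  also have "\<dots> = of_nat N *s u" using N(1) by simp
  finally have "u = inverse (of_nat N) *s (\<Sum>z\<in>Z. pr z)"
    using N(2) by (simp add: vector_smult_assoc)
  moreover have "pr z \<in> vec.span {v \<in> U. \<exists>z. A *v v = z *s v}" if "z \<in> Z" for z
    using prU eig[OF that] by (intro vec.span_base) auto
  ultimately show ?thesis
    by (metis (no_types, lifting) vec.span_scale vec.span_sum)
qed

lemma span_joint_eigenvectors:
  fixes F :: "('a::alg_closed_field ^ 'n ^ 'n) set"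
  assumes "finite F" and N: "N > 0" "of_nat N \<noteq> (0 :: 'a)"
    and ord: "\<And>A v. A \<in> F \<Longrightarrow> mat_pow A N v = v"
    and comm: "\<And>A B. A \<in> F \<Longrightarrow> B \<in> F \<Longrightarrow> A ** B = B ** A"
  shows "vec.span {v. \<forall>A\<in>F. \<exists>z. A *v v = z *s v} = UNIV"
  using assms(1,4,5)
proof (induction F rule: finite_induct)
  case empty
  then show ?case by simp
next
  case (insert A F)
  have IH: "vec.span {v. \<forall>A\<in>F. \<exists>z. A *v v = z *s v} = UNIV"
    by (rule insert.IH) (use insert.prems in blast)+
  have "{v. \<forall>A\<in>F. \<exists>z. A *v v = z *s v} \<subseteq> vec.span {v. \<forall>B\<in>insert A F. \<exists>z. B *v v = z *s v}"
  proof
    fix u assume "u \<in> {v. \<forall>A\<in>F. \<exists>z. A *v v = z *s v}"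
    then obtain z where z: "\<And>B. B \<in> F \<Longrightarrow> B *v u = z B *s u" by simp metis
    define U where "U = {v. \<forall>B\<in>F. B *v v = z B *s v}"
    have sub: "vec.subspace U"
      by (rule vec.subspaceI) (auto simp: U_def vec.add vec.scale vec.scale_right_distrib vector_smult_assoc mult.commute)
    have AU: "A *v v \<in> U" if v: "v \<in> U" for v
    proof -
      have "B *v (A *v v) = z B *s (A *v v)" if B: "B \<in> F" for B
      proof -
        have "B ** A = A ** B" using insert.prems(2)[of B A] B by simp
        then have "B *v (A *v v) = A *v (B *v v)" by (simp add: matrix_vector_mul_assoc)
        then show ?thesis using v B by (simp add: U_def vec.scale)
      qed
      then show ?thesis by (simp add: U_def)
    qed
    have "u \<in> vec.span {v \<in> U. \<exists>z. A *v v = z *s v}"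
      by (rule span_eigenvectors_step[OF N _ AU sub]) (use insert.prems(1) z in \<open>auto simp: U_def\<close>)
    moreover have "{v \<in> U. \<exists>z. A *v v = z *s v} \<subseteq> {v. \<forall>B\<in>insert A F. \<exists>z. B *v v = z *s v}"
      by (auto simp: U_def)
    ultimately show "u \<in> vec.span {v. \<forall>B\<in>insert A F. \<exists>z. B *v v = z *s v}"
      using vec.span_mono by blast
  qed
  then have "vec.span {v. \<forall>A\<in>F. \<exists>z. A *v v = z *s v} \<subseteq> vec.span {v. \<forall>B\<in>insert A F. \<exists>z. B *v v = z *s v}"
    by (rule vec.span_minimal) (rule vec.subspace_span)
  then show ?case using IH by blast
qed

text \<open>
  The columns of \<open>P\<close> are a basis consisting of joint eigenvectors.
\<close>

lemma exists_joint_eigenbasis: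
  fixes F :: "('a::alg_closed_field ^ 'n ^ 'n) set"
  assumes "finite F" and N: "N > 0" "of_nat N \<noteq> (0 :: 'a)"
    and ord: "\<And>A v. A \<in> F \<Longrightarrow> mat_pow A N v = v"
    and comm: "\<And>A B. A \<in> F \<Longrightarrow> B \<in> F \<Longrightarrow> A ** B = B ** A"
  shows "\<exists>(P :: 'a ^ 'n ^ 'n) z. invertible P \<and> (\<forall>A\<in>F. A ** P = P ** diagonal_of (z A))"
proof -
  let ?E = "{v. \<forall>A\<in>F. \<exists>z. A *v v = z *s v}"
  have span: "vec.span ?E = UNIV" by (rule span_joint_eigenvectors[OF assms])
  obtain B where B: "B \<subseteq> ?E" "vec.independent B" "?E \<subseteq> vec.span B"
    by (rule vec.maximal_independent_subset)
  have spanB: "vec.span B = UNIV"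
    using vec.span_minimal[OF B(3) vec.subspace_span] span by blast
  have "vec.dim (UNIV :: ('a ^ 'n) set) = card B"
    by (rule vec.dim_eq_card) (use spanB B(2) in simp_all)
  then have "card B = CARD('n)" using vec_dim_card by metis
  moreover have "finite B" using B(2) vec.finiteI_independent by blast
  ultimately obtain b where b: "bij_betw b (UNIV :: 'n set) B"
    using finite_same_card_bij[of "UNIV :: 'n set" B] by auto
  define P :: "'a ^ 'n ^ 'n" where "P = (\<chi> i j. b j $ i)"
  have col: "column j P = b j" for j by (simp add: column_def P_def Finite_Cartesian_Product.vec_eq_iff)
  have "columns P = B" using b by (auto simp: columns_def col bij_betw_def)
  then have inv: "invertible P"
    unfolding invertible_right_inverse matrix_right_invertible_span_columns by (simp add: spanB)
  have "\<exists>z. A *v b j = z *s b j" if "A \<in> F" for A j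
    using B(1) b that by (auto simp: bij_betw_def)
  then have "\<exists>z. \<forall>A j. A \<in> F \<longrightarrow> A *v b j = z A j *s b j" by (intro choice allI) simp
  then obtain z where z: "\<And>A j. A \<in> F \<Longrightarrow> A *v b j = z A j *s b j" by blast
  have "A ** P = P ** diagonal_of (z A)" if A: "A \<in> F" for A
  proof -
    have "(A ** P) $ i $ j = (P ** diagonal_of (z A)) $ i $ j" for i j
    proof -
      have "(A ** P) $ i $ j = (A *v b j) $ i"
        by (simp add: matrix_matrix_mult_def matrix_vector_mult_def P_def)
      also have "\<dots> = b j $ i * z A j" by (simp add: z[OF A])
      also have "\<dots> = (\<Sum>k\<in>UNIV. if k = j then b k $ i * z A k else 0)" by simp
      also have "\<dots> = (\<Sum>k\<in>UNIV. P $ i $ k * diagonal_of (z A) $ k $ j)"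
        by (intro sum.cong) (auto simp: P_def diagonal_of_def)
      also have "\<dots> = (P ** diagonal_of (z A)) $ i $ j"
        by (simp add: matrix_matrix_mult_def)
      finally show ?thesis .
    qed
    then show ?thesis by (simp add: Finite_Cartesian_Product.vec_eq_iff)
  qed
  then show ?thesis using inv by blast
qed

section \<open>Diagonal substitutions\<close>

text \<open>
  In characteristic \<open>p\<close> there are \<open>N\<close> roots of \<open>X\<^sup>N - 1\<close> whenever \<open>N\<close> is 1 modulo \<open>p\<close>, and a finite field
  cannot hold them when \<open>N\<close> exceeds its cardinality.
\<close>

lemma infinite_alg_closed_field: "infinite (UNIV :: 'a::alg_closed_field set)"
proof
  assume fin: "finite (UNIV :: 'a set)"
  define N where "N = card (UNIV :: 'a set) * CHAR('a) + 1"
  have "CHAR('a) > 0" using finite_imp_CHAR_pos[OF fin] .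
  then have "card (UNIV :: 'a set) < N" by (simp add: N_def less_Suc_eq_le)
  moreover have "card {z :: 'a. z ^ N = 1} = N"
    by (rule card_roots_of_unity) (simp_all add: N_def)
  moreover have "card {z :: 'a. z ^ N = 1} \<le> card (UNIV :: 'a set)"
    by (rule card_mono[OF fin]) simp
  ultimately show False by simp
qed

lemma comm_ring_hom_to_ac: "comm_ring_hom to_ac"
  by standard simp_all

lemma comm_ring_hom_inverse:
  fixes h :: "'a::field \<Rightarrow> 'b::field"
  assumes "comm_ring_hom h"
  shows "h (inverse x) = inverse (h x)"
proof -
  interpret h: comm_ring_hom h by fact
  show ?thesis
  proof (cases "x = 0")
    case False
    then have "h x * h (inverse x) = 1" by (simp flip: h.hom_mult)
    then show ?thesis by (simp add: inverse_unique)
  qed simp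
qed

lemma map_matrix_mult:
  assumes "comm_ring_hom h"
  shows "map_matrix h (A ** B) = map_matrix h A ** map_matrix h B"
proof -
  interpret h: comm_ring_hom h by fact
  show ?thesis
    by (simp add: Finite_Cartesian_Product.vec_eq_iff matrix_matrix_mult_def h.hom_sum h.hom_mult)
qed

lemma map_matrix_mat_1:
  assumes "comm_ring_hom h"
  shows "map_matrix h (Finite_Cartesian_Product.mat 1) = Finite_Cartesian_Product.mat 1"
proof -
  interpret h: comm_ring_hom h by fact
  show ?thesis
    by (simp add: Finite_Cartesian_Product.vec_eq_iff Finite_Cartesian_Product.mat_def)
qed

lemma matrix_mult_diagonal_of: "(A ** diagonal_of d) $ i $ j = A $ i $ j * d j"
proof -
  have "(A ** diagonal_of d) $ i $ j = (\<Sum>k\<in>UNIV. A $ i $ k * diagonal_of d $ k $ j)"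
    by (simp add: matrix_matrix_mult_def)
  also have "\<dots> = (\<Sum>k\<in>UNIV. if k = j then A $ i $ k * d k else 0)"
    by (intro sum.cong) (auto simp: diagonal_of_def)
  finally show ?thesis by simp
qed

lemma diagonal_of_mult: "diagonal_of a ** diagonal_of b = diagonal_of (\<lambda>j. a j * b j)"
  by (simp add: Finite_Cartesian_Product.vec_eq_iff matrix_mult_diagonal_of) (simp add: diagonal_of_def)

lemma diagonal_of_one: "diagonal_of (\<lambda>_. 1) = Finite_Cartesian_Product.mat 1"
  by (simp add: Finite_Cartesian_Product.vec_eq_iff diagonal_of_def Finite_Cartesian_Product.mat_def)

lemma diagonal_of_inject: "diagonal_of a = diagonal_of b \<Longrightarrow> a j = b j"
  by (drule arg_cong[where f = "\<lambda>M. M $ j $ j"]) (simp add: diagonal_of_def)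

lemma invertible_diagonal_of:
  fixes d :: "'n::finite \<Rightarrow> 'a::field"
  assumes "\<And>j. d j \<noteq> 0"
  shows "invertible (diagonal_of d)"
  unfolding invertible_def using assms
  by (intro exI[of _ "diagonal_of (\<lambda>j. inverse (d j))"]) (simp add: diagonal_of_mult diagonal_of_one)

lemma (in group) sum_multiplicative_eq_0:
  fixes \<theta> :: "'a \<Rightarrow> 'f::field"
  assumes mult: "\<And>g h. g \<in> carrier G \<Longrightarrow> h \<in> carrier G \<Longrightarrow> \<theta> (g \<otimes> h) = \<theta> g * \<theta> h"
    and h: "h \<in> carrier G" "\<theta> h \<noteq> 1"
  shows "(\<Sum>g\<in>carrier G. \<theta> g) = 0"
proof -
  have "(\<Sum>g\<in>carrier G. \<theta> g) = (\<Sum>g\<in>carrier G. \<theta> (h \<otimes> g))"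
    by (rule sum.reindex_bij_witness[where i = "\<lambda>g. h \<otimes> g" and j = "\<lambda>g. inv h \<otimes> g"])
      (use h in \<open>simp_all flip: m_assoc\<close>)
  also have "\<dots> = \<theta> h * (\<Sum>g\<in>carrier G. \<theta> g)"
    by (simp add: mult h sum_distrib_left)
  finally show ?thesis using h(2) by (metis mult_cancel_right mult_1)
qed

lemma mpoly_map_inject:
  assumes "comm_ring_hom h" "inj h"
  shows "inj (mpoly_map h)"
proof (rule injI)
  fix p q assume "mpoly_map h p = mpoly_map h q"
  then have "h (Poly_Mapping.lookup p m) = h (Poly_Mapping.lookup q m)" for m
    by (simp flip: lookup_mpoly_map[OF assms(1)])
  then show "p = q" using injD[OF assms(2)] by (intro poly_mapping_eqI) blast
qed

lemma lookup_mpoly_const_mult: "Poly_Mapping.lookup (mpoly_const s * r) m = s * Poly_Mapping.lookup r m"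
proof -
  have "mpoly_const s * r = Poly_Mapping.map ((*) s) r"
    by (simp add: mpoly_const_def mult_map_scale_conv_mult)
  then show ?thesis by (simp add: Poly_Mapping.map.rep_eq when_def)
qed

text \<open>
  If the scalar is the same on all monomials of numerator and denominator, it cancels. The
  hypothesis compares only monomials of the numerator with monomials of the denominator: through
  a monomial on the other side, this settles monomials on the same side as well. Comparing
  only across the fraction bar is what later gives relations of norm at most \<open>d\<close> and not \<open>2d\<close>.
\<close>

lemma ratfun_subst_diagonal_fixed:
  fixes p q :: "('n::{finite,linorder}, 'k::field) mpoly"
  assumes d: "\<And>j. d j \<noteq> 0" and q: "q \<noteq> 0"
    and eq: "\<And>\<mu> \<nu>. \<mu> \<in> Poly_Mapping.keys p \<Longrightarrow> \<nu> \<in> Poly_Mapping.keys q \<Longrightarrow> monom_eval d \<mu> = monom_eval d \<nu>"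
  shows "ratfun_subst (diagonal_of d) (Fract p q) = Fract p q"
proof (cases "p = 0")
  case True
  interpret A: comm_ring_hom "mpoly_subst (diagonal_of d)" by (rule comm_ring_hom_mpoly_subst)
  show ?thesis
    using True q invertible_diagonal_of[of d, OF d] by (simp add: ratfun_subst_Fract eq_fract mpoly_subst_nonzero)
next
  case False
  have keys: "\<exists>\<mu>. \<mu> \<in> Poly_Mapping.keys r" if "r \<noteq> 0" for r :: "('n, 'k) mpoly"
    using that by (metis equals0I keys_eq_empty)
  obtain \<mu>0 \<nu>0 where \<mu>0: "\<mu>0 \<in> Poly_Mapping.keys p" and \<nu>0: "\<nu>0 \<in> Poly_Mapping.keys q"
    using keys[OF False] keys[OF q] by blast
  define s where "s = monom_eval d \<mu>0"
  have scale: "mpoly_subst (diagonal_of d) r = mpoly_const s * r"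
    if "\<And>m. m \<in> Poly_Mapping.keys r \<Longrightarrow> monom_eval d m = s" for r
  proof (rule poly_mapping_eqI)
    fix m
    show "Poly_Mapping.lookup (mpoly_subst (diagonal_of d) r) m = Poly_Mapping.lookup (mpoly_const s * r) m"
      using that[of m] by (cases "m \<in> Poly_Mapping.keys r") (auto simp: lookup_mpoly_subst_diag lookup_mpoly_const_mult in_keys_iff)
  qed
  have "monom_eval d m = s" if "m \<in> Poly_Mapping.keys q" for m
    using eq[OF \<mu>0 that] by (simp add: s_def)
  moreover have "monom_eval d m = s" if "m \<in> Poly_Mapping.keys p" for m
    using eq[OF that \<nu>0] eq[OF \<mu>0 \<nu>0] by (simp add: s_def)
  moreover have "mpoly_const s \<noteq> (0 :: ('n, 'k) mpoly)"
  proof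
    assume "mpoly_const s = (0 :: ('n, 'k) mpoly)"
    then have "Poly_Mapping.lookup (mpoly_const s :: ('n, 'k) mpoly) 0 = 0" by simp
    then show False using d by (simp add: mpoly_const_def s_def)
  qed
  ultimately show ?thesis
    using q invertible_diagonal_of[of d, OF d] by (simp add: ratfun_subst_Fract scale eq_fract mult_ac)
qed

section \<open>Invariants in eigencoordinates\<close>

text \<open>
  A representation together with eigencoordinates over the algebraic closure: \<open>\<xi> g j\<close> is the
  eigenvalue of \<open>g\<close> on the \<open>j\<close>-th column of \<open>P\<close>.
\<close>

locale diagonal_rep = finite_matrix_rep G \<rho>
  for G :: "('g, 'x) monoid_scheme" (structure)
    and \<rho> :: "'g \<Rightarrow> 'k::field ^ 'n::{finite,linorder} ^ 'n::{finite,linorder}" +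
  fixes P :: "'k alg_closure ^ 'n::{finite,linorder} ^ 'n::{finite,linorder}" and \<xi> :: "'g \<Rightarrow> 'n \<Rightarrow> 'k alg_closure"
  assumes invertible_P: "invertible P"
    and diagonal: "g \<in> carrier G \<Longrightarrow> map_matrix to_ac (\<rho> g) ** P = P ** diagonal_of (\<xi> g)"
    and order_nonzero: "of_nat (Coset.order G) \<noteq> (0 :: 'k alg_closure)"
begin

lemma P_left_cancel: "P ** A = P ** B \<longleftrightarrow> A = B"
proof
  assume eq: "P ** A = P ** B"
  obtain Q where Q: "Q ** P = Finite_Cartesian_Product.mat 1" using invertible_P unfolding invertible_def by blast
  have "Q ** (P ** A) = Q ** (P ** B)" using eq by simp
  then show "A = B" by (simp add: matrix_mul_assoc Q)
qed simp

lemma column_nonzero: "\<exists>i. P $ i $ j \<noteq> 0"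
proof (rule ccontr)
  assume "\<not> ?thesis"
  then have zero: "P $ k $ j = 0" for k by simp
  obtain Q where Q: "Q ** P = Finite_Cartesian_Product.mat 1" using invertible_P unfolding invertible_def by blast
  have "(Q ** P) $ j $ j = (\<Sum>k\<in>UNIV. Q $ j $ k * P $ k $ j)" by (simp add: matrix_matrix_mult_def)
  then show False using zero by (simp add: Q Finite_Cartesian_Product.mat_def)
qed

lemma chi_mult:
  assumes "g \<in> carrier G" "h \<in> carrier G"
  shows "\<xi> (g \<otimes> h) j = \<xi> g j * \<xi> h j"
proof -
  have "P ** diagonal_of (\<xi> (g \<otimes> h)) = map_matrix to_ac (\<rho> g) ** (map_matrix to_ac (\<rho> h) ** P)"
    using assms diagonal[of "g \<otimes> h"] by (simp add: rep_mult map_matrix_mult[OF comm_ring_hom_to_ac] matrix_mul_assoc)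
  also have "\<dots> = P ** diagonal_of (\<lambda>j. \<xi> g j * \<xi> h j)"
    using assms by (simp add: diagonal matrix_mul_assoc flip: diagonal_of_mult)
  finally show ?thesis unfolding P_left_cancel by (rule diagonal_of_inject)
qed

lemma chi_one: "\<xi> \<one> j = 1"
proof -
  have "P ** diagonal_of (\<xi> \<one>) = P ** diagonal_of (\<lambda>_. 1)"
    using diagonal[OF one_closed]
    by (simp add: rep_one map_matrix_mat_1[OF comm_ring_hom_to_ac] diagonal_of_one)
  then show ?thesis unfolding P_left_cancel by (rule diagonal_of_inject)
qed

lemma chi_nonzero: "g \<in> carrier G \<Longrightarrow> \<xi> g j \<noteq> 0"
  using chi_mult[of g "inv g" j] chi_one by auto

lemma monom_eval_chi_mult:
  assumes "g \<in> carrier G" "h \<in> carrier G"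
  shows "monom_eval (\<xi> (g \<otimes> h)) m = monom_eval (\<xi> g) m * monom_eval (\<xi> h) m"
  by (simp add: chi_mult[OF assms] power_mult_distrib prod.distrib)

text \<open>
  A polynomial function rewritten in eigencoordinates; there the group acts by diagonal
  substitutions.
\<close>

definition coords :: "('n, 'k) mpoly \<Rightarrow> ('n, 'k alg_closure) mpoly" where
  "coords p = mpoly_subst P (mpoly_map to_ac p)"

lemma comm_ring_hom_coords: "comm_ring_hom coords"
  unfolding coords_def
  by (rule comm_ring_hom_compose[OF comm_ring_hom_mpoly_subst comm_ring_hom_mpoly_map[OF comm_ring_hom_to_ac]])

lemma inj_coords: "inj coords"
  using inj_compose[OF inj_mpoly_subst[OF invertible_P] mpoly_map_inject[OF comm_ring_hom_to_ac inj_to_ac]]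
  by (simp add: coords_def[abs_def] o_def)

lemma coords_subst:
  assumes "g \<in> carrier G"
  shows "coords (mpoly_subst (\<rho> g) p) = mpoly_subst (diagonal_of (\<xi> g)) (coords p)"
  by (simp add: coords_def mpoly_map_subst[OF comm_ring_hom_to_ac] mpoly_subst_subst diagonal[OF assms])

lemma mpoly_degree_coords_le: "mpoly_degree (coords p) \<le> mpoly_degree p"
proof -
  interpret a: comm_ring_hom "to_ac :: 'k \<Rightarrow> _" by (rule comm_ring_hom_to_ac)
  have "mpoly_degree (mpoly_map to_ac p) \<le> mpoly_degree p"
    unfolding mpoly_degree_le_iff
    using monom_degree_le[of _ p] by (auto simp: in_keys_iff lookup_mpoly_map[OF comm_ring_hom_to_ac])
  then show ?thesis
    unfolding coords_def using mpoly_degree_subst_le order_trans by blast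
qed

definition embed :: "('n, 'k) ratfun \<Rightarrow> ('n, 'k alg_closure) ratfun" where
  "embed = fract_hom (\<lambda>p. Fract (coords p) 1)"

lemma
  shows comm_ring_hom_Fract_coords: "comm_ring_hom (\<lambda>p. Fract (coords p) 1)"
    and inj_Fract_coords: "inj (\<lambda>p. Fract (coords p) 1)"
  using comm_ring_hom_compose[OF comm_ring_hom_Fract comm_ring_hom_coords]
    inj_compose[OF inj_Fract inj_coords] by (simp_all add: o_def)

lemma comm_ring_hom_embed: "comm_ring_hom embed"
  unfolding embed_def
  by (rule comm_ring_hom_fract_hom[OF comm_ring_hom_Fract_coords inj_Fract_coords])

lemma embed_Fract: "q \<noteq> 0 \<Longrightarrow> embed (Fract p q) = Fract (coords p) (coords q)"
  unfolding embed_def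
  by (subst fract_hom_Fract[OF comm_ring_hom_Fract_coords inj_Fract_coords]) simp_all

lemma coords_nonzero: "q \<noteq> 0 \<Longrightarrow> coords q \<noteq> 0"
proof -
  interpret c: comm_ring_hom coords by (rule comm_ring_hom_coords)
  show "q \<noteq> 0 \<Longrightarrow> coords q \<noteq> 0" using injD[OF inj_coords, of q 0] by auto
qed

text \<open>
  For a character \<open>\<psi>\<close>, the order of the group times the projection to the polynomials on which \<open>g\<close> acts as \<open>\<psi> g\<close>.
\<close>

definition isotypic :: "('g \<Rightarrow> 'k alg_closure) \<Rightarrow> ('n, 'k alg_closure) mpoly \<Rightarrow> ('n, 'k alg_closure) mpoly" where
  "isotypic \<psi> p = (\<Sum>g\<in>carrier G. mpoly_const (inverse (\<psi> g)) * mpoly_subst (diagonal_of (\<xi> g)) p)"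

text \<open>
  By orthogonality of characters, the projection keeps exactly the monomials with character \<open>\<psi>\<close>.
\<close>

lemma lookup_isotypic:
  assumes "\<And>g h. g \<in> carrier G \<Longrightarrow> h \<in> carrier G \<Longrightarrow> \<psi> (g \<otimes> h) = \<psi> g * \<psi> h"
    and nz: "\<And>g. g \<in> carrier G \<Longrightarrow> \<psi> g \<noteq> 0"
  shows "Poly_Mapping.lookup (isotypic \<psi> p) m =
    (if \<forall>g\<in>carrier G. monom_eval (\<xi> g) m = \<psi> g
     then of_nat (Coset.order G) * Poly_Mapping.lookup p m else 0)"
proof -
  let ?\<theta> = "\<lambda>g. inverse (\<psi> g) * monom_eval (\<xi> g) m"
  have eq: "Poly_Mapping.lookup (isotypic \<psi> p) m = (\<Sum>g\<in>carrier G. ?\<theta> g) * Poly_Mapping.lookup p m"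
    by (simp add: isotypic_def lookup_sum lookup_mpoly_const_mult lookup_mpoly_subst_diag sum_distrib_left mult_ac)
  show ?thesis
  proof (cases "\<forall>g\<in>carrier G. monom_eval (\<xi> g) m = \<psi> g")
    case True
    then have "(\<Sum>g\<in>carrier G. ?\<theta> g) = of_nat (Coset.order G)"
      by (simp add: nz Coset.order_def)
    then show ?thesis using True eq by simp
  next
    case False
    then obtain h where h: "h \<in> carrier G" "monom_eval (\<xi> h) m \<noteq> \<psi> h" by blast
    have z: "(\<Sum>g\<in>carrier G. ?\<theta> g) = 0"
    proof (rule sum_multiplicative_eq_0[OF _ h(1)])
      show "?\<theta> (g \<otimes> h) = ?\<theta> g * ?\<theta> h" if "g \<in> carrier G" "h \<in> carrier G" for g h
        using that by (simp add: assms(1) monom_eval_chi_mult)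
      show "?\<theta> h \<noteq> 1"
        using h nz[OF h(1)] by (simp add: field_simps)
    qed
    show ?thesis unfolding if_not_P[OF False] eq by (simp only: z mult_zero_left)
  qed
qed

text \<open>
  The numerator and denominator can be made semi-invariant, with a common character, without raising
  their degrees. Let \<open>\<psi>\<close> be the character of one monomial of the denominator. Multiplication by the
  invariant \<open>f\<close> commutes with the projection to the \<open>\<psi>\<close>-component, so replacing both by
  their \<open>\<psi>\<close>-components does not change the quotient, and the new denominator is not zero.
\<close>

lemma semi_invariant_representation:
  assumes "f \<in> invariant_field G \<rho>"
  obtains p q where "q \<noteq> 0" "embed f = Fract p q" "mpoly_degree p + mpoly_degree q \<le> ratfun_degree f"
    "\<And>\<mu> \<nu> g. \<mu> \<in> Poly_Mapping.keys p \<Longrightarrow> \<nu> \<in> Poly_Mapping.keys q \<Longrightarrow> g \<in> carrier G \<Longrightarrow>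
       monom_eval (\<xi> g) \<mu> = monom_eval (\<xi> g) \<nu>"
proof -
  obtain p q where pq: "q \<noteq> 0" "f = Fract p q" "ratfun_degree f = mpoly_degree p + mpoly_degree q"
    by (rule ratfun_degree_representation)
  interpret c: comm_ring_hom coords by (rule comm_ring_hom_coords)
  have inv: "mpoly_subst (diagonal_of (\<xi> g)) (coords p) * coords q
           = coords p * mpoly_subst (diagonal_of (\<xi> g)) (coords q)" if g: "g \<in> carrier G" for g
  proof -
    have "ratfun_subst (\<rho> (inv (inv g))) f = f" using assms g unfolding invariant_field_def by blast
    then have "Fract (mpoly_subst (\<rho> g) p) (mpoly_subst (\<rho> g) q) = Fract p q"
      using g pq rep_invertible[OF g] by (simp add: ratfun_subst_Fract)
    then have "mpoly_subst (\<rho> g) p * q = p * mpoly_subst (\<rho> g) q"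
      using pq(1) mpoly_subst_nonzero[OF rep_invertible[OF g]] by (simp add: eq_fract)
    then have "coords (mpoly_subst (\<rho> g) p * q) = coords (p * mpoly_subst (\<rho> g) q)" by simp
    then show ?thesis by (simp add: c.hom_mult coords_subst[OF g])
  qed
  obtain \<nu>0 where \<nu>0: "\<nu>0 \<in> Poly_Mapping.keys (coords q)"
    using coords_nonzero[OF pq(1)] by (metis equals0I keys_eq_empty)
  define \<psi> where "\<psi> = (\<lambda>g. monom_eval (\<xi> g) \<nu>0)"
  have \<psi>_mult: "\<psi> (g \<otimes> h) = \<psi> g * \<psi> h" if "g \<in> carrier G" "h \<in> carrier G" for g h
    using that by (simp add: \<psi>_def monom_eval_chi_mult)
  have \<psi>_nz: "\<psi> g \<noteq> 0" if "g \<in> carrier G" for g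
    using that by (simp add: \<psi>_def chi_nonzero)
  note lk = lookup_isotypic[of \<psi>, OF \<psi>_mult \<psi>_nz]
  have keys: "m \<in> Poly_Mapping.keys r" "\<And>g. g \<in> carrier G \<Longrightarrow> monom_eval (\<xi> g) m = \<psi> g"
    if "m \<in> Poly_Mapping.keys (isotypic \<psi> r)" for m r
    using that lk[of r m] by (auto simp: in_keys_iff split: if_splits)
  have deg: "mpoly_degree (isotypic \<psi> r) \<le> mpoly_degree r" for r
    unfolding mpoly_degree_le_iff using keys(1) monom_degree_le by blast
  show thesis
  proof (rule that)
    have "Poly_Mapping.lookup (isotypic \<psi> (coords q)) \<nu>0 \<noteq> 0"
      using \<nu>0 order_nonzero lk[of "coords q" \<nu>0] by (simp add: \<psi>_def in_keys_iff)
    then show nz: "isotypic \<psi> (coords q) \<noteq> 0" by auto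
    have "isotypic \<psi> (coords p) * coords q = coords p * isotypic \<psi> (coords q)"
      unfolding isotypic_def sum_distrib_left sum_distrib_right
    proof (intro sum.cong refl)
      fix g assume g: "g \<in> carrier G"
      let ?c = "mpoly_const (inverse (\<psi> g)) :: ('n, 'k alg_closure) mpoly"
        and ?D = "mpoly_subst (diagonal_of (\<xi> g))"
      have "?c * ?D (coords p) * coords q = ?c * (?D (coords p) * coords q)" by (rule mult.assoc)
      also have "\<dots> = ?c * (coords p * ?D (coords q))" by (simp only: inv[OF g])
      also have "\<dots> = coords p * (?c * ?D (coords q))" by (rule mult.left_commute)
      finally show "?c * ?D (coords p) * coords q = coords p * (?c * ?D (coords q))" .
    qed
    then show "embed f = Fract (isotypic \<psi> (coords p)) (isotypic \<psi> (coords q))"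
      using nz coords_nonzero[OF pq(1)] pq(1,2) by (simp add: embed_Fract eq_fract)
    show "mpoly_degree (isotypic \<psi> (coords p)) + mpoly_degree (isotypic \<psi> (coords q)) \<le> ratfun_degree f"
      using deg[of "coords p"] deg[of "coords q"] mpoly_degree_coords_le[of p] mpoly_degree_coords_le[of q] pq(3)
      by linarith
    show "monom_eval (\<xi> g) \<mu> = monom_eval (\<xi> g) \<nu>"
      if "\<mu> \<in> Poly_Mapping.keys (isotypic \<psi> (coords p))" "\<nu> \<in> Poly_Mapping.keys (isotypic \<psi> (coords q))"
        "g \<in> carrier G" for \<mu> \<nu> g
      using keys(2)[OF that(1,3)] keys(2)[OF that(2,3)] by simp
  qed
qed

text \<open>
  A one-parameter torus acts on rational functions in eigencoordinates by multiplying \<open>y\<^sub>j\<close> by \<open>t powi w j\<close>. If it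
  fixes \<open>S\<close>, it fixes the field generated by \<open>S\<close>, and an element algebraic over this field can only
  be moved to one of the finitely many roots of its equation. For a variable \<open>x\<^sub>i\<close> that involves
  \<open>y\<^sub>j\<close>, the coefficient of \<open>y\<^sub>j\<close> is multiplied by \<open>t powi w j\<close>, which takes infinitely many values unless \<open>w j = 0\<close>.
\<close>

lemma torus_fixing_basis_is_trivial:
  fixes w :: "'n \<Rightarrow> int"
  assumes alg: "\<And>f. algebraic_over (generate_field ring_of_type_algebra (range ratfun_const \<union> S)) f"
    and fixed: "\<And>t f. t \<noteq> 0 \<Longrightarrow> f \<in> S \<Longrightarrow>
      ratfun_subst (diagonal_of (\<lambda>j. t powi w j)) (embed f) = embed f"
  shows "w j = 0"
proof (rule ccontr)
  assume wj: "w j \<noteq> 0"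
  let ?L = "generate_field ring_of_type_algebra (range ratfun_const \<union> S)"
  define \<tau> where "\<tau> t = ratfun_subst (diagonal_of (\<lambda>j. t powi w j))" for t :: "'k alg_closure"
  interpret e: comm_ring_hom embed by (rule comm_ring_hom_embed)
  have inv: "invertible (diagonal_of (\<lambda>j. t powi w j))" if "t \<noteq> 0" for t :: "'k alg_closure"
    using that by (intro invertible_diagonal_of) simp
  have \<tau>hom: "comm_ring_hom (\<tau> t)" if "t \<noteq> 0" for t
    unfolding \<tau>_def by (rule comm_ring_hom_ratfun_subst[OF inv[OF that]])
  have fixL: "\<tau> t (embed f) = embed f" if t: "t \<noteq> 0" and f: "f \<in> ?L" for t f
  proof -
    interpret \<tau>: comm_ring_hom "\<tau> t" by (rule \<tau>hom[OF t])
    have "?L \<subseteq> {f. \<tau> t (embed f) = embed f}"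
    proof (rule generate_field_subset)
      show "subfield {f. \<tau> t (embed f) = embed f} ring_of_type_algebra"
        by (rule type_subfieldI)
          (simp_all add: e.hom_add \<tau>.hom_add e.hom_mult \<tau>.hom_mult e.hom_uminus \<tau>.hom_uminus
            comm_ring_hom_inverse[OF comm_ring_hom_embed] comm_ring_hom_inverse[OF \<tau>hom[OF t]])
      have "\<tau> t (embed (ratfun_const x)) = embed (ratfun_const x)" for x
      proof -
        interpret c: comm_ring_hom coords by (rule comm_ring_hom_coords)
        have "coords (mpoly_const x) = mpoly_const (to_ac x)"
          by (simp add: coords_def mpoly_map_const[OF comm_ring_hom_to_ac])
        then have "embed (ratfun_const x) = ratfun_const (to_ac x)"
          by (simp add: ratfun_const_def embed_Fract)
        then show ?thesis unfolding \<tau>_def by (simp add: ratfun_subst_const[OF inv[OF t]])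
      qed
      then show "range ratfun_const \<union> S \<subseteq> {f. \<tau> t (embed f) = embed f}"
        using fixed[OF t] by (auto simp: \<tau>_def)
    qed
    then show ?thesis using f by blast
  qed
  obtain i where i: "P $ i $ j \<noteq> 0" using column_nonzero by blast
  let ?x = "Fract (mpoly_var i) 1 :: ('n, 'k) ratfun"
  obtain p where p: "p \<noteq> 0" "\<And>k. Polynomial.coeff p k \<in> ?L" "poly p ?x = 0"
    using alg[of ?x] unfolding algebraic_over_iff[OF generate_field_is_type_subfield] by blast
  have inj_embed: "embed f \<noteq> 0" if "f \<noteq> 0" for f
  proof
    assume "embed f = 0"
    then have "embed (f * inverse f) = 0" unfolding e.hom_mult by simp
    then show False using that by simp
  qed
  define R where "R = {y. poly (map_poly embed p) y = 0}"
  have "map_poly embed p \<noteq> 0"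
  proof
    assume "map_poly embed p = 0"
    then have "embed (Polynomial.lead_coeff p) = 0" by (metis coeff_map_poly e.hom_zero coeff_0)
    then show False using inj_embed[of "Polynomial.lead_coeff p"] p(1) by simp
  qed
  then have finR: "finite R" unfolding R_def by (rule poly_roots_finite)
  have inR: "\<tau> t (embed ?x) \<in> R" if t: "t \<noteq> 0" for t
  proof -
    interpret \<tau>: comm_ring_hom "\<tau> t" by (rule \<tau>hom[OF t])
    have "map_poly (\<tau> t) (map_poly embed p) = map_poly embed p"
      by (rule poly_eqI) (simp add: coeff_map_poly fixL[OF t p(2)])
    then have "poly (map_poly embed p) (\<tau> t (embed ?x)) = \<tau> t (poly (map_poly embed p) (embed ?x))"
      using poly_map_poly_hom[OF \<tau>hom[OF t], of "map_poly embed p" "embed ?x"] by simp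
    also have "poly (map_poly embed p) (embed ?x) = embed (poly p ?x)"
      by (rule poly_map_poly_hom[OF comm_ring_hom_embed])
    finally show ?thesis by (simp add: R_def p(3))
  qed
  define xt where "xt t = mpoly_subst (diagonal_of (\<lambda>j. t powi w j)) (coords (mpoly_var i))" for t
  have \<tau>x: "\<tau> t (embed ?x) = Fract (xt t) 1" if t: "t \<noteq> 0" for t
  proof -
    interpret c: comm_ring_hom coords by (rule comm_ring_hom_coords)
    interpret s: comm_ring_hom "mpoly_subst (diagonal_of (\<lambda>j. t powi w j))" by (rule comm_ring_hom_mpoly_subst)
    show ?thesis by (simp add: \<tau>_def xt_def embed_Fract ratfun_subst_Fract[OF inv[OF t]])
  qed
  have lookup_xt: "Poly_Mapping.lookup (xt t) (Poly_Mapping.single j 1) = P $ i $ j * t powi w j" for t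
  proof -
    have "coords (mpoly_var i) = (\<Sum>k\<in>UNIV. Poly_Mapping.single (Poly_Mapping.single k 1) (P $ i $ k))"
      unfolding coords_def mpoly_map_var[OF comm_ring_hom_to_ac] mpoly_subst_var
      by (simp add: mpoly_const_def mpoly_var_def mult_single)
    moreover have "(Poly_Mapping.single k (1::nat) = Poly_Mapping.single j 1) = (k = j)" for k
      by (metis keys_single singleton_inject zero_neq_one)
    ultimately have "Poly_Mapping.lookup (coords (mpoly_var i)) (Poly_Mapping.single j 1) = P $ i $ j"
      by (simp add: lookup_sum lookup_single when_def)
    then show ?thesis by (simp add: xt_def lookup_mpoly_subst_diag)
  qed
  have "(\<lambda>q. Fract q 1) ` xt ` {t. t \<noteq> 0} \<subseteq> R" using inR \<tau>x by auto
  then have "finite (xt ` {t. t \<noteq> 0})"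
    using finR finite_imageD[OF finite_subset inj_on_subset[OF inj_Fract subset_UNIV]] by blast
  then have "finite ((\<lambda>q. Poly_Mapping.lookup q (Poly_Mapping.single j 1) / P $ i $ j) ` xt ` {t. t \<noteq> 0})"
    by (rule finite_imageI)
  then have finV: "finite ((\<lambda>t. t powi w j) ` {t :: 'k alg_closure. t \<noteq> 0})"
    using i by (simp add: image_image lookup_xt[unfolded One_nat_def])
  have "(UNIV :: 'k alg_closure set) = insert 0 (\<Union>v\<in>(\<lambda>t. t powi w j) ` {t. t \<noteq> 0}. {x. x \<noteq> 0 \<and> x powi w j = v})"
    by auto
  moreover have "finite \<dots>"
    using finV card_powi_roots(1)[OF wj] by blast
  ultimately show False using infinite_alg_closed_field by metis
qed

section \<open>The lower bound\<close>

text \<open>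
  Restricted to the carrier because characters are compared as extensional functions.
\<close>

definition column_char :: "'n \<Rightarrow> 'g \<Rightarrow> 'k alg_closure" where
  "column_char j = restrict (\<lambda>g. \<xi> g j) (carrier G)"

lemma column_char_occurs:
  assumes "h \<in> carrier G" "\<xi> h j \<noteq> 1"
  shows "column_char j \<in> nontrivial_characters_in G \<rho>"
proof -
  have "column_char j \<in> characters G"
    by (auto simp: characters_def column_char_def hom_def type_ring_simps chi_nonzero chi_mult)
  moreover have "occurs_in G \<rho> (column_char j)"
    unfolding occurs_in_def
  proof (intro exI[of _ "column j P"] conjI ballI)
    show "column j P \<noteq> 0"
      using column_nonzero[of j] by (simp add: Finite_Cartesian_Product.vec_eq_iff column_def)
    fix g assume g: "g \<in> carrier G"
    have "(map_matrix to_ac (\<rho> g) *v column j P) $ i = (map_matrix to_ac (\<rho> g) ** P) $ i $ j" for i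
      by (simp add: matrix_vector_mult_def matrix_matrix_mult_def column_def)
    then show "map_matrix to_ac (\<rho> g) *v column j P = column_char j g *s column j P"
      using g by (simp add: Finite_Cartesian_Product.vec_eq_iff diagonal matrix_mult_diagonal_of
          column_def column_char_def mult.commute)
  qed
  moreover have "column_char j h \<noteq> 1" using assms by (simp add: column_char_def)
  ultimately show ?thesis
    using assms(1) unfolding nontrivial_characters_in_def by blast
qed

text \<open>
  Wherever an eigenvector has a nonzero eigencoordinate, its character is that of the coordinate. So
  the nontrivial characters that occur are exactly those of the columns, and no exponent is lost in
  the multidegree.
\<close>

lemma occurring_character_is_column_char:
  assumes "\<psi> \<in> nontrivial_characters_in G \<rho>"
  shows "\<exists>j. column_char j = \<psi>"
proof -
  have ext: "\<psi> \<in> extensional (carrier G)"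
    using assms by (simp add: nontrivial_characters_in_def characters_def)
  obtain v where v: "v \<noteq> 0" "\<And>g. g \<in> carrier G \<Longrightarrow> map_matrix to_ac (\<rho> g) *v v = \<psi> g *s v"
    using assms unfolding nontrivial_characters_in_def occurs_in_def by blast
  obtain Q where Q: "Q ** P = Finite_Cartesian_Product.mat 1" "P ** Q = Finite_Cartesian_Product.mat 1"
    using invertible_P unfolding invertible_def by blast
  define c where "c = Q *v v"
  have Pc: "P *v c = v" by (simp add: c_def matrix_vector_mul_assoc Q)
  then have "c \<noteq> 0" using v(1) by auto
  then obtain j where j: "c $ j \<noteq> 0" by (auto simp: Finite_Cartesian_Product.vec_eq_iff)
  have "\<psi> g = \<xi> g j" if g: "g \<in> carrier G" for g
  proof -
    have "P *v (diagonal_of (\<xi> g) *v c) = map_matrix to_ac (\<rho> g) *v (P *v c)"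
      by (simp add: matrix_vector_mul_assoc diagonal[OF g])
    also have "\<dots> = \<psi> g *s v" by (simp add: Pc v(2)[OF g])
    finally have "Q *v (P *v (diagonal_of (\<xi> g) *v c)) = \<psi> g *s c"
      by (simp add: c_def vec.scale)
    then have "diagonal_of (\<xi> g) *v c = \<psi> g *s c"
      by (simp add: matrix_vector_mul_assoc matrix_mul_assoc Q)
    moreover have "(diagonal_of (\<xi> g) *v c) $ j = \<xi> g j * c $ j"
    proof -
      have "(diagonal_of (\<xi> g) *v c) $ j = (\<Sum>k\<in>UNIV. diagonal_of (\<xi> g) $ j $ k * c $ k)"
        by (simp add: matrix_vector_mult_def)
      also have "\<dots> = (\<Sum>k\<in>UNIV. if k = j then \<xi> g j * c $ k else 0)"
        by (intro sum.cong) (auto simp: diagonal_of_def)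
      finally show ?thesis by simp
    qed
    ultimately show ?thesis using j by simp
  qed
  then have "column_char j = \<psi>"
    using ext by (intro extensionalityI[of _ "carrier G"]) (simp_all add: column_char_def)
  then show ?thesis by blast
qed

lemma faithful_chi:
  assumes "inj_on \<rho> (carrier G)" "g \<in> carrier G" "h \<in> carrier G" and eq: "\<And>j. \<xi> g j = \<xi> h j"
  shows "g = h"
proof -
  obtain Q where Q: "P ** Q = Finite_Cartesian_Product.mat 1" using invertible_P unfolding invertible_def by blast
  have "map_matrix to_ac (\<rho> g) ** P = map_matrix to_ac (\<rho> h) ** P"
    using eq assms(2,3) by (simp add: diagonal ext[of "\<xi> g" "\<xi> h"])
  then have "map_matrix to_ac (\<rho> g) ** (P ** Q) = map_matrix to_ac (\<rho> h) ** (P ** Q)"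
    by (simp add: matrix_mul_assoc)
  then have "map_matrix to_ac (\<rho> g) = map_matrix to_ac (\<rho> h)" by (simp add: Q)
  then have "\<rho> g = \<rho> h" by (simp add: Finite_Cartesian_Product.vec_eq_iff)
  then show ?thesis using assms(1-3) by (auto dest: inj_onD)
qed

text \<open>
  The counting argument. The points \<open>t g = (\<chi>\<^sub>1(g), \<dots>, \<chi>\<^sub>m(g))\<close> of the torus are distinct for
  distinct \<open>g\<close>, and all of them satisfy the relations in \<open>D\<close> that come from the basis \<open>S\<close>.
\<close>

lemma order_le_power:
  assumes faithful: "inj_on \<rho> (carrier G)"
    and e: "bij_betw e {..<m} (nontrivial_characters_in G \<rho>)"
    and S: "S \<subseteq> {f \<in> invariant_field G \<rho>. ratfun_degree f \<le> d}"
    and basis: "transcendence_basis ratfun_const (invariant_field G \<rho>) S"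
  shows "Coset.order G \<le> d ^ m"
proof -
  have ek: "e k g = \<xi> g j" if "column_char j = e k" "g \<in> carrier G" for k g j
    using that by (metis column_char_def restrict_apply')
  have e_col: "\<exists>j. column_char j = e k" if "k < m" for k
    using occurring_character_is_column_char bij_betwE[OF e] that by blast
  have e_inj: "e k = e l \<longleftrightarrow> k = l" if "k < m" "l < m" for k l
    using e that by (auto simp: bij_betw_def inj_on_def)
  have e_surj: "\<exists>k<m. column_char j = e k" if "g \<in> carrier G" "\<xi> g j \<noteq> 1" for j g
    using column_char_occurs[OF that] e by (metis bij_betw_iff_bijections lessThan_iff)
  \<comment> \<open>The multidegree: exponents of eigencoordinates with the same nontrivial character are
      added up, and those of invariant coordinates are forgotten.\<close>
  define md where "md \<mu> k = (\<Sum>j\<in>UNIV. if column_char j = e k then Poly_Mapping.lookup \<mu> j else 0)"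
    for \<mu> :: "'n \<Rightarrow>\<^sub>0 nat" and k
  define t where "t g k = (if k < m then e k g else 1)" for g and k :: nat
  obtain p q where q: "\<And>f. f \<in> S \<Longrightarrow> q f \<noteq> 0"
    and emb: "\<And>f. f \<in> S \<Longrightarrow> embed f = Fract (p f) (q f)"
    and deg: "\<And>f. f \<in> S \<Longrightarrow> mpoly_degree (p f) + mpoly_degree (q f) \<le> d"
    and semi: "\<And>f \<mu> \<nu> g. f \<in> S \<Longrightarrow> \<mu> \<in> Poly_Mapping.keys (p f) \<Longrightarrow> \<nu> \<in> Poly_Mapping.keys (q f) \<Longrightarrow>
      g \<in> carrier G \<Longrightarrow> monom_eval (\<xi> g) \<mu> = monom_eval (\<xi> g) \<nu>"
  proof -
    have "\<exists>pq. snd pq \<noteq> 0 \<and> embed f = Fract (fst pq) (snd pq) \<and> mpoly_degree (fst pq) + mpoly_degree (snd pq) \<le> d \<and>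
      (\<forall>\<mu>\<in>Poly_Mapping.keys (fst pq). \<forall>\<nu>\<in>Poly_Mapping.keys (snd pq). \<forall>g\<in>carrier G.
        monom_eval (\<xi> g) \<mu> = monom_eval (\<xi> g) \<nu>)" if f: "f \<in> S" for f
    proof -
      have inv: "f \<in> invariant_field G \<rho>" and d: "ratfun_degree f \<le> d" using S f by auto
      obtain p q where *: "q \<noteq> 0" "embed f = Fract p q" "mpoly_degree p + mpoly_degree q \<le> ratfun_degree f"
        "\<And>\<mu> \<nu> g. \<mu> \<in> Poly_Mapping.keys p \<Longrightarrow> \<nu> \<in> Poly_Mapping.keys q \<Longrightarrow> g \<in> carrier G \<Longrightarrow>
           monom_eval (\<xi> g) \<mu> = monom_eval (\<xi> g) \<nu>"
        by (rule semi_invariant_representation[OF inv]) blast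
      show ?thesis
        by (rule exI[of _ "(p, q)"]) (use * d in auto)
    qed
    then have "\<exists>pq. \<forall>f\<in>S. snd (pq f) \<noteq> 0 \<and> embed f = Fract (fst (pq f)) (snd (pq f)) \<and>
      mpoly_degree (fst (pq f)) + mpoly_degree (snd (pq f)) \<le> d \<and>
      (\<forall>\<mu>\<in>Poly_Mapping.keys (fst (pq f)). \<forall>\<nu>\<in>Poly_Mapping.keys (snd (pq f)). \<forall>g\<in>carrier G.
        monom_eval (\<xi> g) \<mu> = monom_eval (\<xi> g) \<nu>)"
      by (intro bchoice ballI)
    then obtain pq where "\<forall>f\<in>S. snd (pq f) \<noteq> 0 \<and> embed f = Fract (fst (pq f)) (snd (pq f)) \<and>
      mpoly_degree (fst (pq f)) + mpoly_degree (snd (pq f)) \<le> d \<and>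
      (\<forall>\<mu>\<in>Poly_Mapping.keys (fst (pq f)). \<forall>\<nu>\<in>Poly_Mapping.keys (snd (pq f)). \<forall>g\<in>carrier G.
        monom_eval (\<xi> g) \<mu> = monom_eval (\<xi> g) \<nu>)" ..
    then show ?thesis using that[of "\<lambda>f. snd (pq f)" "\<lambda>f. fst (pq f)"] by blast
  qed
  define D where "D = {(\<lambda>k. int (md \<mu> k) - int (md \<nu> k)) | f \<mu> \<nu>.
    f \<in> S \<and> \<mu> \<in> Poly_Mapping.keys (p f) \<and> \<nu> \<in> Poly_Mapping.keys (q f)}"
  have monom: "monom_eval (\<xi> g) \<mu> = (\<Prod>k<m. t g k ^ md \<mu> k)" if g: "g \<in> carrier G" for g \<mu>
  proof -
    have "(\<Prod>k<m. t g k ^ md \<mu> k) = (\<Prod>k<m. \<Prod>j\<in>UNIV. if column_char j = e k then \<xi> g j ^ Poly_Mapping.lookup \<mu> j else 1)"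
      unfolding md_def power_sum
      by (intro prod.cong refl) (auto simp: t_def ek[OF _ g])
    also have "\<dots> = (\<Prod>j\<in>UNIV. \<Prod>k<m. if column_char j = e k then \<xi> g j ^ Poly_Mapping.lookup \<mu> j else 1)"
      by (rule prod.swap)
    also have "\<dots> = (\<Prod>j\<in>UNIV. \<xi> g j ^ Poly_Mapping.lookup \<mu> j)"
    proof (rule prod.cong[OF refl])
      fix j
      show "(\<Prod>k<m. if column_char j = e k then \<xi> g j ^ Poly_Mapping.lookup \<mu> j else 1) = \<xi> g j ^ Poly_Mapping.lookup \<mu> j"
      proof (cases "\<exists>k<m. column_char j = e k")
        case True
        then obtain k where k: "k < m" "column_char j = e k" by blast
        have "(\<Prod>l<m. if column_char j = e l then \<xi> g j ^ Poly_Mapping.lookup \<mu> j else 1)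
            = (\<Prod>l<m. if l = k then \<xi> g j ^ Poly_Mapping.lookup \<mu> j else 1)"
          using k e_inj by (intro prod.cong) auto
        then show ?thesis using k(1) by simp
      next
        case False
        then have "\<xi> g j = 1" using e_surj[OF g] by blast
        then show ?thesis by (simp add: prod.neutral)
      qed
    qed
    also have "\<dots> = monom_eval (\<xi> g) \<mu>" by (rule monom_eval_superset[symmetric]) auto
    finally show ?thesis by simp
  qed
  have t_nz: "t g k \<noteq> 0" if g: "g \<in> carrier G" for g k
  proof (cases "k < m")
    case True
    then obtain j where "column_char j = e k" using e_col by blast
    from ek[OF this g] show ?thesis using True chi_nonzero[OF g] by (simp add: t_def)
  qed (simp add: t_def)
  have "inj_on t (carrier G)"
  proof (rule inj_onI)
    fix g h assume gh: "g \<in> carrier G" "h \<in> carrier G" "t g = t h"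
    have "\<xi> g j = \<xi> h j" for j
    proof (cases "\<exists>k<m. column_char j = e k")
      case True
      then obtain k where "k < m" "column_char j = e k" by blast
      then show ?thesis
        using ek[of j k g] ek[of j k h] gh(1,2) fun_cong[OF gh(3), of k] by (simp add: t_def)
    next
      case False
      then show ?thesis using e_surj gh by metis
    qed
    then show "g = h" by (rule faithful_chi[OF faithful gh(1,2)])
  qed
  then have "Coset.order G = card (t ` carrier G)" by (simp add: card_image Coset.order_def)
  also have "\<dots> \<le> d ^ m"
  proof (rule card_common_solutions_le[of m D])
    show "(\<Sum>k<m. \<bar>v k\<bar>) \<le> int d" if v: "v \<in> D" for v
    proof -
      obtain f \<mu> \<nu> where f: "f \<in> S" "\<mu> \<in> Poly_Mapping.keys (p f)" "\<nu> \<in> Poly_Mapping.keys (q f)"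
        and v_eq: "v = (\<lambda>k. int (md \<mu> k) - int (md \<nu> k))" using v unfolding D_def by blast
      have md_le: "(\<Sum>k<m. md \<mu> k) \<le> monom_degree \<mu>" for \<mu>
      proof -
        have "(\<Sum>k<m. md \<mu> k) = (\<Sum>j\<in>UNIV. \<Sum>k<m. if column_char j = e k then Poly_Mapping.lookup \<mu> j else 0)"
          unfolding md_def by (rule sum.swap)
        also have "\<dots> \<le> (\<Sum>j\<in>UNIV. Poly_Mapping.lookup \<mu> j)"
        proof (rule sum_mono)
          fix j
          show "(\<Sum>k<m. if column_char j = e k then Poly_Mapping.lookup \<mu> j else 0) \<le> Poly_Mapping.lookup \<mu> j"
          proof (cases "\<exists>k<m. column_char j = e k")
            case True
            then obtain k where k: "k < m" "column_char j = e k" by blast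
            have "(\<Sum>l<m. if column_char j = e l then Poly_Mapping.lookup \<mu> j else 0)
                = (\<Sum>l<m. if l = k then Poly_Mapping.lookup \<mu> j else 0)"
              using k e_inj by (intro sum.cong) auto
            then show ?thesis using k(1) by simp
          next
            case False
            then show ?thesis by (simp add: sum.neutral)
          qed
        qed
        also have "\<dots> = monom_degree \<mu>" by (rule monom_degree_superset[symmetric]) auto
        finally show ?thesis .
      qed
      have "(\<Sum>k<m. \<bar>v k\<bar>) \<le> (\<Sum>k<m. int (md \<mu> k) + int (md \<nu> k))"
        unfolding v_eq by (intro sum_mono) linarith
      also have "\<dots> = int ((\<Sum>k<m. md \<mu> k) + (\<Sum>k<m. md \<nu> k))" by (simp add: sum.distrib)
      also have "\<dots> \<le> int d"
        using md_le[of \<mu>] md_le[of \<nu>] monom_degree_le[OF f(2)] monom_degree_le[OF f(3)] deg[OF f(1)]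
        by linarith
      finally show ?thesis .
    qed
    show "(\<Prod>k<m. s k powi v k) = 1" if "s \<in> t ` carrier G" "v \<in> D" for s v
    proof -
      obtain g where g: "g \<in> carrier G" "s = t g" using \<open>s \<in> t ` carrier G\<close> by blast
      obtain f \<mu> \<nu> where f: "f \<in> S" "\<mu> \<in> Poly_Mapping.keys (p f)" "\<nu> \<in> Poly_Mapping.keys (q f)"
        and v_eq: "v = (\<lambda>k. int (md \<mu> k) - int (md \<nu> k))" using \<open>v \<in> D\<close> unfolding D_def by blast
      have "(\<Prod>k<m. s k powi v k) = (\<Prod>k<m. t g k ^ md \<mu> k / t g k ^ md \<nu> k)"
        unfolding v_eq g(2) using t_nz[OF g(1)] by (intro prod.cong refl) (simp add: power_int_diff)
      also have "\<dots> = monom_eval (\<xi> g) \<mu> / monom_eval (\<xi> g) \<nu>"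
        by (simp only: prod_dividef monom[OF g(1)])
      also have "\<dots> = 1"
        using semi[OF f g(1)] chi_nonzero[OF g(1)] by simp
      finally show ?thesis .
    qed
    show "s k \<noteq> 0" if "s \<in> t ` carrier G" for s k using that t_nz by blast
    show "s k = 1" if "s \<in> t ` carrier G" "m \<le> k" for s k using that by (auto simp: t_def)
    show "\<exists>v\<in>D. (\<Sum>k<m. w k * v k) \<noteq> 0" if w: "\<exists>k<m. w k \<noteq> 0" for w
    proof (rule ccontr)
      assume "\<not> ?thesis"
      then have perp: "(\<Sum>k<m. w k * v k) = 0" if "v \<in> D" for v using that by blast
      \<comment> \<open>A vector orthogonal to all relations becomes the weight vector of a torus that fixes \<open>S\<close>.\<close>
      define W where "W j = (\<Sum>k<m. if column_char j = e k then w k else 0)" for j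
      have weight: "(\<Sum>j\<in>UNIV. W j * int (Poly_Mapping.lookup \<mu> j)) = (\<Sum>k<m. w k * int (md \<mu> k))" for \<mu>
      proof -
        have "(\<Sum>j\<in>UNIV. W j * int (Poly_Mapping.lookup \<mu> j))
            = (\<Sum>j\<in>UNIV. \<Sum>k<m. w k * (if column_char j = e k then int (Poly_Mapping.lookup \<mu> j) else 0))"
          unfolding W_def sum_distrib_right by (intro sum.cong refl) simp
        also have "\<dots> = (\<Sum>k<m. \<Sum>j\<in>UNIV. w k * (if column_char j = e k then int (Poly_Mapping.lookup \<mu> j) else 0))"
          by (rule sum.swap)
        also have "\<dots> = (\<Sum>k<m. w k * int (md \<mu> k))"
          unfolding md_def of_nat_sum sum_distrib_left by (intro sum.cong refl) simp
        finally show ?thesis .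
      qed
      have monom_weight: "monom_eval (\<lambda>j. s powi W j) \<mu> = s powi (\<Sum>k<m. w k * int (md \<mu> k))"
        if s: "s \<noteq> 0" for s :: "'k alg_closure" and \<mu>
      proof -
        have "monom_eval (\<lambda>j. s powi W j) \<mu> = (\<Prod>j\<in>UNIV. s powi (W j * int (Poly_Mapping.lookup \<mu> j)))"
          by (subst monom_eval_superset[of UNIV]) (simp_all add: power_int_mult)
        also have "\<dots> = s powi (\<Sum>j\<in>UNIV. W j * int (Poly_Mapping.lookup \<mu> j))"
          using s by (rule powi_sum[symmetric])
        finally show ?thesis by (simp only: weight)
      qed
      have "W j = 0" for j
      proof (rule torus_fixing_basis_is_trivial)
        show "algebraic_over (generate_field ring_of_type_algebra (range ratfun_const \<union> S)) f" for f
          by (rule algebraic_over_transcendence_basis[OF basis])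
        show "ratfun_subst (diagonal_of (\<lambda>j. s powi W j)) (embed f) = embed f" if s: "s \<noteq> 0" and f: "f \<in> S" for s f
          unfolding emb[OF f]
        proof (rule ratfun_subst_diagonal_fixed[OF _ q[OF f]])
          show "s powi W j \<noteq> 0" for j using s by simp
          fix \<mu> \<nu> assume \<mu>\<nu>: "\<mu> \<in> Poly_Mapping.keys (p f)" "\<nu> \<in> Poly_Mapping.keys (q f)"
          then have "(\<lambda>k. int (md \<mu> k) - int (md \<nu> k)) \<in> D" using f unfolding D_def by blast
          from perp[OF this] have "(\<Sum>k<m. w k * int (md \<mu> k)) = (\<Sum>k<m. w k * int (md \<nu> k))"
            by (simp add: right_diff_distrib sum_subtractf)
          then show "monom_eval (\<lambda>j. s powi W j) \<mu> = monom_eval (\<lambda>j. s powi W j) \<nu>"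
            by (simp only: monom_weight[OF s])
        qed
      qed
      moreover obtain k where k: "k < m" "w k \<noteq> 0" using w by blast
      moreover obtain j where j: "column_char j = e k" using e_col[OF k(1)] by blast
      have "W j = (\<Sum>l<m. if l = k then w k else 0)"
        unfolding W_def using k(1) j e_inj by (intro sum.cong) auto
      then have "W j = w k" using k(1) by simp
      ultimately show False by simp
    qed
  qed
  finally show ?thesis .
qed

end

lemma (in finite_matrix_rep) mat_pow_rep:
  assumes "g \<in> carrier G"
  shows "mat_pow (map_matrix to_ac (\<rho> g)) n v = map_matrix to_ac (\<rho> (g [^] n)) *v v"
proof (induction n)
  case 0
  show ?case by (simp add: mat_pow_def rep_one map_matrix_mat_1[OF comm_ring_hom_to_ac])
next
  case (Suc n)
  have "mat_pow (map_matrix to_ac (\<rho> g)) (Suc n) v = map_matrix to_ac (\<rho> g) *v mat_pow (map_matrix to_ac (\<rho> g)) n v"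
    by (simp add: mat_pow_def)
  also have "\<dots> = (map_matrix to_ac (\<rho> g) ** map_matrix to_ac (\<rho> (g [^] n))) *v v"
    by (simp add: Suc matrix_vector_mul_assoc)
  also have "\<dots> = map_matrix to_ac (\<rho> (g [^] Suc n)) *v v"
    using assms nat_pow_Suc2[OF assms, of n]
    by (simp only: map_matrix_mult[OF comm_ring_hom_to_ac, symmetric] rep_mult nat_pow_closed)
  finally show ?case .
qed

theorem theorem4p1:
  fixes G :: "('g, 'x) monoid_scheme"
    and \<rho> :: "'g \<Rightarrow> 'k::field ^ 'n::{finite,linorder} ^ 'n::{finite,linorder}"
    and m :: nat
  assumes "comm_group G" and "finite (carrier G)"
    and "\<not> CHAR('k) dvd Coset.order G"
    and "\<rho> \<in> hom G GL" and "inj_on \<rho> (carrier G)"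
    and "m = card (nontrivial_characters_in G \<rho>)" and "m \<ge> 1"
  shows "real (gamma_field_r G \<rho>) \<ge> root m (real (Coset.order G))"
proof -
  interpret comm_group G by fact
  interpret finite_matrix_rep G \<rho>
    by unfold_locales (use assms in auto)
  let ?R = "\<lambda>g. map_matrix to_ac (\<rho> g)"
  have N0: "of_nat (Coset.order G) \<noteq> (0 :: 'k alg_closure)"
    using assms(3) by (simp add: of_nat_eq_0_iff_char_dvd)
  have "\<exists>(P :: 'k alg_closure ^ 'n::{finite,linorder} ^ 'n::{finite,linorder}) z. invertible P \<and> (\<forall>A\<in>?R ` carrier G. A ** P = P ** diagonal_of (z A))"
  proof (rule exists_joint_eigenbasis[of _ "Coset.order G"])
    show "finite (?R ` carrier G)" using assms(2) by simp
    show "0 < Coset.order G" using assms(2) by (simp add: order_gt_0_iff_finite)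
    show "mat_pow A (Coset.order G) v = v" if "A \<in> ?R ` carrier G" for A v
      using that by (auto simp: mat_pow_rep pow_order_eq_1 rep_one map_matrix_mat_1[OF comm_ring_hom_to_ac])
    show "A ** B = B ** A" if "A \<in> ?R ` carrier G" "B \<in> ?R ` carrier G" for A B
      using that by (auto simp: map_matrix_mult[OF comm_ring_hom_to_ac, symmetric] rep_mult[symmetric] m_comm)
  qed (rule N0)
  then obtain P :: "'k alg_closure ^ 'n::{finite,linorder} ^ 'n::{finite,linorder}" and z
    where P: "invertible P" "\<And>g. g \<in> carrier G \<Longrightarrow> ?R g ** P = P ** diagonal_of (z (?R g))" by blast
  interpret diagonal_rep G \<rho> P "\<lambda>g. z (?R g)"
    by unfold_locales (use P N0 in auto)
  \<comment> \<open>A least element has the defining property only because some \<open>d\<close> has it.\<close>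
  let ?ok = "\<lambda>d. 0 < d \<and> (\<exists>S \<subseteq> {f \<in> invariant_field G \<rho>. ratfun_degree f \<le> d}.
            transcendence_basis ratfun_const (invariant_field G \<rho>) S)"
  have "\<exists>d. ?ok d" using exists_bounded_transcendence_basis by blast
  then have "?ok (gamma_field_r G \<rho>)" unfolding gamma_field_r_def by (rule LeastI_ex)
  then obtain S where S: "S \<subseteq> {f \<in> invariant_field G \<rho>. ratfun_degree f \<le> gamma_field_r G \<rho>}"
    "transcendence_basis ratfun_const (invariant_field G \<rho>) S" by blast
  have "finite (nontrivial_characters_in G \<rho>)" using assms(6,7) card_ge_0_finite by force
  then obtain e where "bij_betw e {..<m} (nontrivial_characters_in G \<rho>)"
    using ex_bij_betw_nat_finite assms(6) by (metis atLeast0LessThan)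
  from order_le_power[OF assms(5) this S]
  have "real (Coset.order G) \<le> real (gamma_field_r G \<rho>) ^ m" by (metis of_nat_le_iff of_nat_power)
  then have "root m (real (Coset.order G)) \<le> root m (real (gamma_field_r G \<rho>) ^ m)"
    using assms(7) by (intro real_root_le_mono) auto
  also have "\<dots> = real (gamma_field_r G \<rho>)" using assms(7) by (intro real_root_power_cancel) auto
  finally show ?thesis by simp
qed

end
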